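(* Let $s=(s_1,\dots,s_n)$ be a composition and $w,w'$ two Stirling $s$-permutations. There is a cover relation between $w$ and $w'$ in the $s$-weak order if and only if the simplices $\mathrm{conv}\{\mathbf 1_R:R\in\Delta_w\}$ and $\mathrm{conv}\{\mathbf 1_R:R\in\Delta_{w'}\}$ are adjacent in the DKK triangulation of $\mathcal F_{\mathcal O(s)}(\mathbf i)$ (i.e. share a common facet, equivalently $\Delta_w$ and $\Delta_{w'}$ differ in exactly one route).
   Context: A composition has positive entries; $|s|=\sum s_i$; $s_{n+1}:=2$. A Stirling $s$-permutation is a rearrangement of $1^{s_1}\cdots n^{s_n}$ avoiding the pattern $121$. For $a\in[n]$ the $a$-block $B_a$ of $w$ is the shortest factor of $w$ containing all occurrences of $a$; for $a<c$, $|(c,a)_w|$ is the number of occurrences of $c$ preceding $B_a$. The $s$-weak order is: $w\le w'$ iff $|(c,a)_w|\le|(c,a)_{w'}|$ for all $1\le a<c\le n$. The $s$-oruga graph $\mathcal O(s)$ has vertices $v_{-1},\dots,v_n$; for $i\in[n+1]$ source edges $e^i_1,\dots,e^i_{s_i-1}$ from $v_{-1}$ to $v_{n+1-i}$; for $i\in[n]$ the bump $e^i_0$ and dip $e^i_{s_i}$ from $v_{n-i}$ to $v_{n+1-i}$. Framing: incoming at $v_{n+1-i}$: $e^i_0\prec e^i_1\prec\cdots\prec e^i_{s_i}$; outgoing at $v_{n+1-i}$: $e^{i-1}_0\prec e^{i-1}_{s_{i-1}}$. Routes are paths $v_{-1}\to v_n$; $R(k,t,\delta)$ ($k\in[n+1]$,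 $t\in[s_k-1]$, $\delta\in\{0,1\}^{k-1}$) is the route with edges $e^k_t,e^{k-1}_{\delta_{k-1}s_{k-1}},\dots,e^1_{\delta_1s_1}$. Routes $P,Q$ are coherent if on every maximal common subpath $v_a\cdots v_b$ with $v_a\ne v_{-1}$, $v_b\ne v_n$, $P$'s entering edge at $v_a$ precedes $Q$'s iff $P$'s leaving edge at $v_b$ precedes $Q$'s. $\mathcal F_{\mathcal O(s)}(\mathbf i)$ is the polytope of nonnegative unit flows from $v_{-1}$ to $v_n$, the convex hull of route indicator vectors $\mathbf 1_R$; its DKK triangulation consists of the simplices $\mathrm{conv}\{\mathbf 1_R:R\in C\}$ for sets $C$ of pairwise coherent routes. For a prefix $u$ of $w$: $t_a$ = number of $a$'s in $u$; $c$ = least $a\in[n]$ with $0<t_a<s_a$ (else $c=n+1$, $t_{n+1}=1$); $R[u]:=R(c,t_c,(t_1/s_1,\dots,t_{c-1}/s_{c-1}))$. $\Delta_w:=\{R[w_{[i]}]:0\le i\le|s|\}$ where $w_{[i]}$ is the length-$i$ prefix. *)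

theory Defs
  imports "HOL-Analysis.Analysis" "Graph_Theory.Arc_Walk"
begin

section \<open>Stirling permutations and the weak order\<close>

definition composition :: "nat list \<Rightarrow> bool" where
  "composition s \<longleftrightarrow> (\<forall>x\<in>set s. 0 < x)"

text \<open>Parts are indexed from \<open>1\<close>, with the convention that part \<open>n + 1\<close> is \<open>2\<close>.\<close>

definition part :: "nat list \<Rightarrow> nat \<Rightarrow> nat" where
  "part s i = (if i = length s + 1 then 2 else s ! (i - 1))"

definition avoids_121 :: "nat list \<Rightarrow> bool" where
  "avoids_121 w \<longleftrightarrow>
     \<not> (\<exists>i j k. i < j \<and> j < k \<and> k < length w \<and> w ! i = w ! k \<and> w ! i < w ! j)"

definition stirling_perm :: "nat list \<Rightarrow> nat list \<Rightarrow> bool" where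
  "stirling_perm s w \<longleftrightarrow>
     mset w = (\<Sum>a = 1..length s. replicate_mset (part s a) a) \<and> avoids_121 w"

text \<open>\<open>is_block w a u b v\<close>: the word factors as \<open>w = u b v\<close>, where \<open>b\<close> is a shortest factor
  containing all occurrences of \<open>a\<close>, that is, the block \<open>B\<^sub>a\<close>.\<close>

definition is_block :: "nat list \<Rightarrow> nat \<Rightarrow> nat list \<Rightarrow> nat list \<Rightarrow> nat list \<Rightarrow> bool" where
  "is_block w a u b v \<longleftrightarrow>
     w = u @ b @ v \<and> count_list b a = count_list w a \<and>
     (\<forall>u' b' v'. w = u' @ b' @ v' \<and> count_list b' a = count_list w a \<longrightarrow> length b \<le> length b')"

definition before_block :: "nat list \<Rightarrow> nat \<Rightarrow> nat list" where
  "before_block w a = (THE u. \<exists>b v. is_block w a u b v)"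

definition inversions :: "nat list \<Rightarrow> nat \<Rightarrow> nat \<Rightarrow> nat" where
  "inversions w c a = count_list (before_block w a) c"

definition weak_le :: "nat list \<Rightarrow> nat list \<Rightarrow> nat list \<Rightarrow> bool" where
  "weak_le s w w' \<longleftrightarrow>
     (\<forall>a c. 1 \<le> a \<and> a < c \<and> c \<le> length s \<longrightarrow> inversions w c a \<le> inversions w' c a)"

definition weak_less :: "nat list \<Rightarrow> nat list \<Rightarrow> nat list \<Rightarrow> bool" where
  "weak_less s w w' \<longleftrightarrow> weak_le s w w' \<and> w \<noteq> w'"

definition weak_covered :: "nat list \<Rightarrow> nat list \<Rightarrow> nat list \<Rightarrow> bool" where
  "weak_covered s w w' \<longleftrightarrow>
     stirling_perm s w \<and> stirling_perm s w' \<and> weak_less s w w' \<and>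
     \<not> (\<exists>x. stirling_perm s x \<and> weak_less s w x \<and> weak_less s x w')"

section \<open>The oruga graph, its framing and its routes\<close>

text \<open>The vertex \<open>v\<^sub>j\<close> is the integer \<open>j\<close>, and the pair \<open>(i, t)\<close> is the edge of index \<open>t\<close> in the
  family \<open>i\<close>: a source edge if \<open>0 < t < s\<^sub>i\<close>, the bump if \<open>t = 0\<close>, the dip if \<open>t = s\<^sub>i\<close>. The family
  \<open>n + 1\<close> consists of the single source edge \<open>(n + 1, 1)\<close>.\<close>

type_synonym edge = "nat \<times> nat"

definition oruga :: "nat list \<Rightarrow> (int, edge) pre_digraph" where
  "oruga s =
     \<lparr> verts = {-1..int (length s)},
       arcs = {(i, t). i \<in> {1..length s + 1} \<and> t \<in> {1..part s i - 1}}
            \<union> {(i, t). i \<in> {1..length s} \<and> (t = 0 \<or> t = part s i)},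
       tail = (\<lambda>(i, t). if 0 < t \<and> t < part s i then -1 else int (length s) - int i),
       head = (\<lambda>(i, t). int (length s) + 1 - int i) \<rparr>"

definition routes :: "nat list \<Rightarrow> edge list set" where
  "routes s = {P. pre_digraph.apath (oruga s) (-1) P (int (length s))}"

text \<open>The edges entering an inner vertex all belong to one family, and so do the edges leaving
  it. Both framing orders are therefore given by comparing the indices within a family.\<close>

definition framing_less :: "edge \<Rightarrow> edge \<Rightarrow> bool" where
  "framing_less e f \<longleftrightarrow> fst e = fst f \<and> snd e < snd f"

text \<open>The list \<open>M\<close> is the common subpath, which may be a single vertex (\<open>M = []\<close>, whence the
  condition on the heads). The inequalities of the entering and of the leaving edges express its
  maximality; that these edges exist means that the subpath neither starts at the source nor ends
  at the sink.\<close>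

definition coherent :: "nat list \<Rightarrow> edge list \<Rightarrow> edge list \<Rightarrow> bool" where
  "coherent s P Q \<longleftrightarrow>
     (\<forall>P\<^sub>1 p M p' P\<^sub>2 Q\<^sub>1 q q' Q\<^sub>2.
        P = P\<^sub>1 @ [p] @ M @ [p'] @ P\<^sub>2 \<and> Q = Q\<^sub>1 @ [q] @ M @ [q'] @ Q\<^sub>2 \<and>
        head (oruga s) p = head (oruga s) q \<and> p \<noteq> q \<and> p' \<noteq> q' \<longrightarrow>
        (framing_less p q \<longleftrightarrow> framing_less p' q'))"

definition route :: "nat list \<Rightarrow> nat \<Rightarrow> nat \<Rightarrow> (nat \<Rightarrow> nat) \<Rightarrow> edge list" where
  "route s k t \<delta> = (k, t) # map (\<lambda>j. (j, \<delta> j * part s j)) (rev [1..<k])"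

section \<open>The flow polytope and its triangulation\<close>

text \<open>A map \<open>lab :: 'e \<Rightarrow> edge\<close> that is a bijection onto the edges of the oruga graph identifies
  \<open>real ^ 'e\<close> with the space of real functions on these edges.\<close>

definition flow_polytope :: "nat list \<Rightarrow> ('e::finite \<Rightarrow> edge) \<Rightarrow> (real ^ 'e) set" where
  "flow_polytope s lab =
     {f. (\<forall>e. 0 \<le> f $ e) \<and>
         (\<forall>v\<in>verts (oruga s).
            (\<Sum>e | tail (oruga s) (lab e) = v. f $ e) - (\<Sum>e | head (oruga s) (lab e) = v. f $ e)
            = (if v = -1 then 1 else 0) - (if v = int (length s) then 1 else 0))}"

definition route_vector :: "('e::finite \<Rightarrow> edge) \<Rightarrow> edge list \<Rightarrow> real ^ 'e" where
  "route_vector lab R = (\<chi> e. if lab e \<in> set R then 1 else 0)"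

definition route_simplex :: "('e::finite \<Rightarrow> edge) \<Rightarrow> edge list set \<Rightarrow> (real ^ 'e) set" where
  "route_simplex lab C = convex hull (route_vector lab ` C)"

definition dkk_triangulation :: "nat list \<Rightarrow> ('e::finite \<Rightarrow> edge) \<Rightarrow> (real ^ 'e) set set" where
  "dkk_triangulation s lab =
     {route_simplex lab C | C. C \<subseteq> routes s \<and> (\<forall>P\<in>C. \<forall>Q\<in>C. coherent s P Q)}"

definition adjacent_in :: "'a::euclidean_space set set \<Rightarrow> 'a set \<Rightarrow> 'a set \<Rightarrow> bool" where
  "adjacent_in \<T> S T \<longleftrightarrow>
     S \<in> \<T> \<and> T \<in> \<T> \<and> S \<noteq> T \<and> (\<exists>F. F facet_of S \<and> F facet_of T)"

section \<open>The routes attached to a Stirling permutation\<close>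

definition first_open :: "nat list \<Rightarrow> nat list \<Rightarrow> nat" where
  "first_open s u =
     (if \<exists>a\<in>{1..length s}. 0 < count_list u a \<and> count_list u a < part s a
      then LEAST a. a \<in> {1..length s} \<and> 0 < count_list u a \<and> count_list u a < part s a
      else length s + 1)"

text \<open>Below \<open>first_open s u\<close> every letter occurs in \<open>u\<close> either not at all or with its full
  multiplicity, so the integer division is exact.\<close>

definition prefix_route :: "nat list \<Rightarrow> nat list \<Rightarrow> edge list" where
  "prefix_route s u =
     (let c = first_open s u
      in route s c (if c = length s + 1 then 1 else count_list u c)
           (\<lambda>a. count_list u a div part s a))"

definition Delta :: "nat list \<Rightarrow> nat list \<Rightarrow> edge list set" where
  "Delta s w = {prefix_route s (take i w) | i. i \<le> sum_list s}"

section \<open>Consistency of the definitions\<close>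

lemma before_block_eq_takeWhile:
  assumes "a \<in> set w"
  shows "before_block w a = takeWhile (\<lambda>x. x \<noteq> a) w"
proof -
  let ?u = "takeWhile (\<lambda>x. x \<noteq> a) w"
  obtain y where y: "w = ?u @ a # y" "a \<notin> set ?u"
  proof -
    obtain x y where "w = x @ a # y" "a \<notin> set x"
      using split_list_first[OF assms] by blast
    moreover from this have "takeWhile (\<lambda>z. z \<noteq> a) w = x"
      by (metis (mono_tags, lifting) append_Nil2 takeWhile.simps(2) takeWhile_append2)
    ultimately show thesis using that[of y] by simp
  qed
  obtain b v where bv: "a # y = b @ a # v" "a \<notin> set v"
    by (metis list.set_intros(1) split_list_last)
  have w: "w = ?u @ (b @ [a]) @ v" using y bv by simp
  have cu: "count_list ?u a = 0" using y(2) by (simp add: count_list_0_iff)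
  have cv: "count_list v a = 0" using bv(2) by (simp add: count_list_0_iff)
  have c: "count_list (b @ [a]) a = count_list w a"
    using arg_cong[OF w, of "\<lambda>x. count_list x a"] cu cv by simp
  have outside: "a \<notin> set u' \<and> a \<notin> set v'"
    if "w = u' @ b' @ v'" "count_list b' a = count_list w a" for u' b' v'
    using that by (simp add: count_list_0_iff[symmetric])
  have pre: "length u' \<le> length ?u" if "w = u' @ b' @ v'" "a \<notin> set u'" for u' b' v'
  proof -
    have "?u = u' @ takeWhile (\<lambda>x. x \<noteq> a) (b' @ v')"
      unfolding that(1) using that(2) by (subst takeWhile_append2) auto
    then show ?thesis by (metis le_add1 length_append)
  qed
  have post: "length v' \<le> length v" if e: "w = u' @ b' @ v'" and n: "a \<notin> set v'" for u' b' v'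
  proof (rule ccontr)
    assume "\<not> length v' \<le> length v"
    then have l: "length v < length v'" by simp
    have "(?u @ b) @ a # v = (u' @ b') @ v'" using w e by simp
    then obtain z where "z @ v' = a # v \<or> v' = z @ a # v"
      unfolding append_eq_append_conv2 by metis
    then show False
    proof
      assume z: "z @ v' = a # v"
      then have "z = []" using l by (cases z) auto
      then show False using z n by auto
    next
      assume "v' = z @ a # v" then show False using n by auto
    qed
  qed
  have min: "length (b @ [a]) \<le> length b'"
    if e: "w = u' @ b' @ v'" and k: "count_list b' a = count_list w a" for u' b' v'
  proof -
    have "length u' \<le> length ?u" "length v' \<le> length v"
      using pre[OF e] post[OF e] outside[OF e k] by auto
    moreover have "length ?u + length (b @ [a]) + length v = length u' + length b' + length v'"
      using arg_cong[OF w, of length] arg_cong[OF e, of length] by simp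
    ultimately show ?thesis by linarith
  qed
  have blk: "is_block w a ?u (b @ [a]) v"
    unfolding is_block_def using w c min by blast
  have "u' = ?u" if "is_block w a u' b' v'" for u' b' v'
  proof -
    have e: "w = u' @ b' @ v'" and k: "count_list b' a = count_list w a"
      using that unfolding is_block_def by blast+
    have m: "length b' \<le> length (b @ [a])"
      using that w c unfolding is_block_def by blast
    have "length u' \<le> length ?u" "length v' \<le> length v"
      using pre[OF e] post[OF e] outside[OF e k] by auto
    moreover have "length ?u + length (b @ [a]) + length v = length u' + length b' + length v'"
      using arg_cong[OF w, of length] arg_cong[OF e, of length] by simp
    ultimately have "length u' = length ?u" using m by linarith
    moreover have "?u @ (b @ [a]) @ v = u' @ b' @ v'" using w e by metis
    ultimately show ?thesis by (metis append_eq_append_conv)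
  qed
  then show ?thesis
    unfolding before_block_def using blk by blast
qed

lemma wf_digraph_oruga: "wf_digraph (oruga s)"
  by unfold_locales (auto simp: oruga_def)

lemma card_route_edges:
  assumes "bij_betw lab UNIV (arcs (oruga s))" "set R \<subseteq> arcs (oruga s)" "distinct R"
  shows "(\<Sum>e | Q (lab e). route_vector lab R $ e) = real (length (filter Q R))"
proof -
  have "(\<Sum>e | Q (lab e). route_vector lab R $ e) = real (card {e. Q (lab e) \<and> lab e \<in> set R})"
    by (simp add: route_vector_def sum.If_cases Collect_conj_eq Int_commute)
  also have "card {e. Q (lab e) \<and> lab e \<in> set R} = card (lab ` {e. Q (lab e) \<and> lab e \<in> set R})"
    using assms(1) by (intro card_image[symmetric]) (auto simp: bij_betw_def inj_on_def)
  also have "lab ` {e. Q (lab e) \<and> lab e \<in> set R} = set (filter Q R)"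
    using assms(1,2) by (fastforce simp: bij_betw_def)
  also have "card \<dots> = length (filter Q R)"
    using assms(3) by (intro distinct_card) simp
  finally show ?thesis .
qed

lemma cas_balance:
  "pre_digraph.cas G u R v \<Longrightarrow>
   real (length (filter (\<lambda>e. tail G e = x) R)) - real (length (filter (\<lambda>e. head G e = x) R))
   = (if x = u then 1 else 0) - (if x = v then 1 else 0)"
proof (induction R arbitrary: u)
  case Nil
  then show ?case by (simp add: pre_digraph.cas.simps)
next
  case (Cons e R)
  then have "tail G e = u" "pre_digraph.cas G (head G e) R v"
    by (auto simp: pre_digraph.cas.simps)
  with Cons.IH[of "head G e"] show ?case by auto
qed

lemma dkk_simplex_subset_flow_polytope:
  assumes lab: "bij_betw lab UNIV (arcs (oruga s))" and "S \<in> dkk_triangulation s lab"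
  shows "S \<subseteq> flow_polytope s lab"
proof -
  obtain C where C: "C \<subseteq> routes s" "S = convex hull (route_vector lab ` C)"
    using assms(2) unfolding dkk_triangulation_def route_simplex_def by blast
  have "route_vector lab R \<in> flow_polytope s lab" if "R \<in> routes s" for R
  proof -
    have R: "set R \<subseteq> arcs (oruga s)" "pre_digraph.cas (oruga s) (-1) R (int (length s))"
      "distinct R"
      using that wf_digraph.distinct_verts_imp_distinct[OF wf_digraph_oruga]
      by (auto simp: routes_def pre_digraph.apath_def pre_digraph.awalk_def)
    have "route_vector lab R $ e \<ge> 0" for e by (simp add: route_vector_def)
    then show ?thesis
      unfolding flow_polytope_def
      using card_route_edges[OF lab R(1,3), of "\<lambda>e. tail (oruga s) e = _"]
        card_route_edges[OF lab R(1,3), of "\<lambda>e. head (oruga s) e = _"] cas_balance[OF R(2)]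
      by auto
  qed
  moreover have "convex (flow_polytope s lab)"
  proof (rule convexI)
    fix x y and a b :: real
    assume x: "x \<in> flow_polytope s lab" and y: "y \<in> flow_polytope s lab"
      and ab: "0 \<le> a" "0 \<le> b" "a + b = 1"
    have "(\<Sum>e | tail (oruga s) (lab e) = v. (a *\<^sub>R x + b *\<^sub>R y) $ e)
          - (\<Sum>e | head (oruga s) (lab e) = v. (a *\<^sub>R x + b *\<^sub>R y) $ e)
          = (if v = -1 then 1 else 0) - (if v = int (length s) then 1 else 0)"
      (is "?L = ?R") if "v \<in> verts (oruga s)" for v
    proof -
      let ?D = "\<lambda>f. (\<Sum>e | tail (oruga s) (lab e) = v. f $ e)
                   - (\<Sum>e | head (oruga s) (lab e) = v. f $ e)"
      have "?L = a * ?D x + b * ?D y"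
        by (simp add: sum.distrib sum_distrib_left algebra_simps)
      also have "\<dots> = a * ?R + b * ?R"
        using x y that unfolding flow_polytope_def by auto
      also have "\<dots> = ?R" using ab(3) by (metis distrib_right mult_1)
      finally show ?thesis .
    qed
    then show "a *\<^sub>R x + b *\<^sub>R y \<in> flow_polytope s lab"
      using x y ab by (auto simp: flow_polytope_def)
  qed
  ultimately show ?thesis
    unfolding C(2) using C(1) by (intro hull_minimal) auto
qed

end

theory Submission
  imports Defs
begin

text \<open>
  The route of a prefix \<open>u\<close> of \<open>w\<close> records the number of letters \<open>a\<close> in \<open>u\<close> for every \<open>a\<close> up to
  the first open letter of \<open>u\<close>. Along the prefixes these numbers increase, which makes the routes in
  \<open>\<Delta>\<^sub>w\<close> coherent, and linear functionals on flows recover the position in \<open>w\<close>, which makes them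
  affinely independent. Hence two simplices share a facet iff their routes differ in one element.

  A cover moves a letter \<open>y\<close> from behind a block \<open>B\<close> of a smaller letter \<open>b\<close> to its front. For a
  nonempty proper prefix of \<open>B\<close> the letter \<open>b\<close> is open and hides \<open>y\<close> from the route, so the move
  only exchanges the route of the prefix ending with \<open>B\<close> for that of the prefix ending with the moved
  \<open>y\<close>. Conversely, let \<open>w = u x \<dots>\<close> and \<open>w' = u y \<dots>\<close> with \<open>x < y\<close>. The route of the prefix \<open>u Q\<close> of
  \<open>w\<close> before the next \<open>y\<close> is not a route of \<open>w'\<close>; if it is the only one, then \<open>Q\<close> is a single block, and
  \<open>w'\<close> is obtained by the move.
\<close>

section \<open>Words avoiding 121\<close>

text \<open>Splitting at the middle letter of a pattern trades positions for membership, which suits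
  words given as concatenations.\<close>

lemma avoids_121_iff:
  "avoids_121 w \<longleftrightarrow> (\<forall>u c v a. w = u @ c # v \<and> a < c \<longrightarrow> a \<notin> set u \<or> a \<notin> set v)"
proof
  assume av: "avoids_121 w"
  show "\<forall>u c v a. w = u @ c # v \<and> a < c \<longrightarrow> a \<notin> set u \<or> a \<notin> set v"
  proof (intro allI impI, rule ccontr)
    fix u c v a
    assume w: "w = u @ c # v \<and> a < c" and "\<not> (a \<notin> set u \<or> a \<notin> set v)"
    then obtain i k where i: "i < length u" "u ! i = a" and k: "k < length v" "v ! k = a"
      by (auto simp: in_set_conv_nth)
    have "w ! i = a" "w ! length u = c" "w ! (length u + 1 + k) = a"
      using w i k by (auto simp: nth_append)
    moreover have "i < length u" "length u < length u + 1 + k" "length u + 1 + k < length w"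
      using w i k by auto
    ultimately show False using av w unfolding avoids_121_def by metis
  qed
next
  assume *: "\<forall>u c v a. w = u @ c # v \<and> a < c \<longrightarrow> a \<notin> set u \<or> a \<notin> set v"
  show "avoids_121 w"
    unfolding avoids_121_def
  proof (rule notI, elim exE conjE)
    fix i j k
    assume h: "i < j" "j < k" "k < length w" "w ! i = w ! k" "w ! i < w ! j"
    have "w = take j w @ w ! j # drop (Suc j) w"
      using h by (intro id_take_nth_drop) simp
    moreover have "w ! i \<in> set (take j w)"
      using h by (auto simp: in_set_conv_nth intro!: exI[of _ i])
    moreover have "w ! k \<in> set (drop (Suc j) w)"
      using h by (auto simp: in_set_conv_nth intro!: exI[of _ "k - Suc j"])
    ultimately show False using * h by metis
  qed
qed

lemma append_eq_append_Cons_cases: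
  assumes "xs @ ys = g @ c # h"
  shows "(\<exists>t. xs = g @ c # t \<and> h = t @ ys) \<or> (\<exists>t. g = xs @ t \<and> ys = t @ c # h)"
  using assms by (auto simp: append_eq_append_conv2 append_eq_Cons_conv Cons_eq_append_conv)

lemma stirling_121:
  "stirling_perm s (u @ c # v) \<Longrightarrow> a < c \<Longrightarrow> a \<in> set u \<Longrightarrow> a \<notin> set v"
  unfolding stirling_perm_def avoids_121_iff by blast

section \<open>Letter counts of Stirling permutations\<close>

lemma part_pos:
  assumes "composition s" "a \<in> {1..length s}"
  shows "0 < part s a"
  using assms by (auto simp: composition_def part_def)

lemma count_list_stirling:
  assumes "stirling_perm s w" "a \<in> {1..length s}"
  shows "count_list w a = part s a"
proof -
  have "count (mset w) a = (\<Sum>b = 1..length s. if b = a then part s b else 0)"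
    using assms(1) by (simp add: stirling_perm_def count_sum if_distrib cong: if_cong)
  then show ?thesis using assms(2) by (simp add: count_mset)
qed

lemma set_stirling:
  assumes "composition s" "stirling_perm s w"
  shows "set w = {1..length s}"
proof -
  have "set_mset (mset w) = (\<Union>a\<in>{1..length s}. set_mset (replicate_mset (part s a) a))"
    using assms(2) by (simp only: stirling_perm_def set_mset_sum finite_atLeastAtMost)
  also have "\<dots> = {1..length s}"
    using part_pos[OF assms(1)] by (auto simp: set_mset_replicate_mset_subset split: if_splits)
  finally show ?thesis by simp
qed

lemma length_stirling:
  assumes "stirling_perm s w"
  shows "length w = sum_list s"
proof -
  have "length w = size (mset w)" by simp
  also have "\<dots> = (\<Sum>a = 1..length s. part s a)"
    using assms by (simp only: stirling_perm_def size_multiset_sum size_replicate_mset)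
  also have "\<dots> = (\<Sum>a = 1..length s. s ! (a - 1))"
    by (intro sum.cong) (auto simp: part_def)
  also have "\<dots> = (\<Sum>i = 0..<length s. s ! i)"
    by (intro sum.reindex_bij_witness[of _ Suc "\<lambda>a. a - 1"]) auto
  finally show ?thesis by (simp add: sum_list_sum_nth)
qed

text \<open>The occurrences of \<open>a\<close> are divided between the two sides of the cut. In
  this form 121-avoidance applies to open letters.\<close>

lemma open_iff:
  assumes "stirling_perm s (u @ v)" "a \<in> {1..length s}"
  shows "0 < count_list u a \<and> count_list u a < part s a \<longleftrightarrow> a \<in> set u \<and> a \<in> set v"
proof -
  have "part s a = count_list u a + count_list v a"
    using count_list_stirling[OF assms] by simp
  moreover have "count_list x a = 0 \<longleftrightarrow> a \<notin> set x" for x by (simp add: count_list_0_iff)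
  ultimately show ?thesis by (metis gr0I less_add_same_cancel1 less_numeral_extra(3))
qed

section \<open>The routes of the prefixes of a Stirling permutation\<close>

lemma first_open_cases:
  "first_open s u = length s + 1 \<or>
   first_open s u \<in> {1..length s} \<and> 0 < count_list u (first_open s u) \<and>
     count_list u (first_open s u) < part s (first_open s u)"
proof -
  define P where "P a \<longleftrightarrow> a \<in> {1..length s} \<and> 0 < count_list u a \<and> count_list u a < part s a"
    for a
  have "first_open s u = (if \<exists>a. P a then LEAST a. P a else length s + 1)"
    unfolding first_open_def P_def Bex_def by simp
  moreover have "P (LEAST a. P a)" if "\<exists>a. P a" using LeastI_ex[OF that] .
  ultimately show ?thesis unfolding P_def by (auto split: if_splits)
qed

lemma first_open_bounds: "1 \<le> first_open s u" "first_open s u \<le> length s + 1"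
  using first_open_cases[of s u] by auto

lemma first_open_open:
  assumes "first_open s u \<le> length s"
  shows "0 < count_list u (first_open s u)" "count_list u (first_open s u) < part s (first_open s u)"
  using first_open_cases[of s u] assms by auto

lemma first_open_le:
  assumes "a \<in> {1..length s}" "0 < count_list u a" "count_list u a < part s a"
  shows "first_open s u \<le> a"
  using assms by (auto simp: first_open_def intro!: Least_le)

text \<open>By minimality of the first open letter. The two values become the bumps and dips of the
  route.\<close>

lemma before_first_open:
  assumes "stirling_perm s (u @ v)" "a \<in> {1..length s}" "a < first_open s u"
  shows "count_list u a = 0 \<or> count_list u a = part s a"
proof -
  have "count_list u a \<le> part s a"
    using count_list_stirling[OF assms(1,2)] by simp
  then show ?thesis using first_open_le[of a s u] assms by fastforce
qed

lemma le_first_openI: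
  assumes "stirling_perm s (u @ v)" "k \<le> length s + 1"
    and "\<And>a. a < k \<Longrightarrow> a \<in> set u \<Longrightarrow> a \<in> set v \<Longrightarrow> False"
  shows "k \<le> first_open s u"
proof (rule ccontr)
  assume "\<not> k \<le> first_open s u"
  then have c: "first_open s u < k" "first_open s u \<in> {1..length s}"
    using assms(2) first_open_bounds[of s u] by auto
  then show False
    using open_iff[OF assms(1) c(2)] first_open_open[of s u] assms(3) by auto
qed

text \<open>A smaller letter open at the cut would enclose \<open>y\<close> in a 121 pattern. Hence
  the route of \<open>u\<close> still shows how many letters \<open>y\<close> occur in
  \<open>u\<close>; the next lemma gives the same for a cut just after \<open>y\<close>.\<close>

lemma next_le_first_open:
  assumes "composition s" "stirling_perm s (u @ y # v)"
  shows "y \<le> first_open s u"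
proof (rule le_first_openI[OF assms(2)])
  show "y \<le> length s + 1" using set_stirling[OF assms] in_set_conv_decomp[of y "u @ y # v"] by fastforce
qed (use stirling_121[OF assms(2)] in auto)

lemma last_le_first_open:
  assumes "composition s" "stirling_perm s (u @ y # v)"
  shows "y \<le> first_open s (u @ [y])"
proof (rule le_first_openI)
  show "stirling_perm s ((u @ [y]) @ v)" using assms by simp
  show "y \<le> length s + 1" using set_stirling[OF assms] in_set_conv_decomp[of y "u @ y # v"] by fastforce
qed (use stirling_121[OF assms(2)] in auto)

text \<open>Family \<open>length s + 1\<close> has a single edge, of index 1, so there the index is
  fixed rather than counted.\<close>

definition route_index :: "nat list \<Rightarrow> nat list \<Rightarrow> nat \<Rightarrow> nat" where
  "route_index s u j = (if j = length s + 1 then 1 else count_list u j)"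

text \<open>Below the first open letter the quotients are 0 or 1, and multiplying back returns the
  letter counts. Thus one formula covers the source edge, the bumps and the dips.\<close>

lemma prefix_route_eq:
  assumes "composition s" "stirling_perm s (u @ v)"
  shows "prefix_route s u =
    map (\<lambda>j. (j, route_index s u j)) (rev [1..<Suc (first_open s u)])"
proof -
  let ?c = "first_open s u"
  have "count_list u j div part s j * part s j = route_index s u j" if "j \<in> {1..<?c}" for j
  proof -
    have j: "j \<in> {1..length s}" using that first_open_bounds(2)[of s u] by auto
    then show ?thesis
      using before_first_open[OF assms(2) j] that part_pos[OF assms(1) j]
      by (auto simp: route_index_def)
  qed
  moreover have "[1..<Suc ?c] = [1..<?c] @ [?c]" using first_open_bounds(1)[of s u] by simp
  ultimately show ?thesis
    by (auto simp: prefix_route_def route_def Let_def route_index_def)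
qed

lemma prefix_route_cong:
  assumes "mset p = mset p'"
  shows "prefix_route s p = prefix_route s p'"
proof -
  have *: "count_list p = count_list p'" using assms by (metis count_mset ext)
  show ?thesis unfolding prefix_route_def first_open_def * ..
qed

text \<open>The length of a route reveals the first open letter, and its edges reveal the
  counts.\<close>

lemma prefix_route_eq_iff:
  assumes "composition s" "stirling_perm s (u @ v)" "stirling_perm s (u' @ v')"
  shows "prefix_route s u = prefix_route s u' \<longleftrightarrow> first_open s u = first_open s u' \<and>
    (\<forall>j\<in>{1..length s}. j \<le> first_open s u \<longrightarrow> count_list u j = count_list u' j)"
    (is "?L \<longleftrightarrow> ?R")
proof
  assume ?L
  then have e: "map (\<lambda>j. (j, route_index s u j)) (rev [1..<Suc (first_open s u)])
    = map (\<lambda>j. (j, route_index s u' j)) (rev [1..<Suc (first_open s u')])"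
    using prefix_route_eq assms by metis
  have c: "first_open s u = first_open s u'" using arg_cong[OF e, of length] by (simp del: upt_Suc)
  have idx: "route_index s u j = route_index s u' j" if "1 \<le> j" "j \<le> first_open s u" for j
    using e that c by (simp del: upt_Suc)
  have "count_list u j = count_list u' j" if "j \<in> {1..length s}" "j \<le> first_open s u" for j
    using idx[of j] that by (simp add: route_index_def)
  then show ?R using c by blast
next
  assume r: ?R
  have "route_index s u j = route_index s u' j" if "1 \<le> j" "j \<le> first_open s u" for j
    using r that first_open_bounds(2)[of s u] by (auto simp: route_index_def)
  with r show ?L
    unfolding prefix_route_eq[OF assms(1,2)] prefix_route_eq[OF assms(1,3)] by auto
qed

lemma Delta_eq:
  assumes "stirling_perm s w"
  shows "Delta s w = {prefix_route s u | u v. w = u @ v}"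
proof -
  have "prefix_route s u \<in> Delta s w" if "w = u @ v" for u v
    using that length_stirling[OF assms]
    by (auto simp: Delta_def intro!: exI[of _ "length u"])
  moreover have "\<exists>v. w = take i w @ v" for i by (metis append_take_drop_id)
  ultimately show ?thesis unfolding Delta_def by blast
qed

subsection \<open>Affine independence\<close>

text \<open>The sum of these weights along the route of a prefix of \<open>w\<close> tells whether the prefix contains
  the letter at position \<open>i\<close>. Routes whose source edge lies in a family \<open>b < w ! i\<close> do not meet
  the family of that letter, but then it is not in the block of \<open>b\<close>.\<close>

definition position_weight :: "nat list \<Rightarrow> nat list \<Rightarrow> nat \<Rightarrow> edge \<Rightarrow> real" where
  "position_weight s w i = (\<lambda>(b, t).
     if b = w ! i then of_bool (count_list (take (Suc i) w) b \<le> t)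
     else of_bool (b < w ! i \<and> 0 < t \<and> t < part s b \<and> b \<notin> set (take i w)))"

lemma count_list_take_mono: "i \<le> j \<Longrightarrow> count_list (take i w) a \<le> count_list (take j w) a"
  by (metis append_take_drop_id count_list_append le_add1 min.absorb1 take_take)

text \<open>At most one family contributes: that of \<open>w ! i\<close> if this letter does not
  exceed the first open letter, and otherwise that of the first open letter itself.\<close>

lemma position_weight_prefix_route:
  assumes s: "composition s" and w: "stirling_perm s w" and i: "i < length w"
  shows "(\<Sum>e\<in>set (prefix_route s (take m w)). position_weight s w i e) = of_bool (i < m)"
proof -
  let ?u = "take m w" and ?v = "drop m w" and ?a = "w ! i"
  let ?c = "first_open s ?u"
  have uv: "stirling_perm s (?u @ ?v)" using w by simp
  have wi: "w = take i w @ ?a # drop (Suc i) w" by (rule id_take_nth_drop[OF i])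
  have a: "?a \<in> {1..length s}" using set_stirling[OF s w] i nth_mem by blast
  let ?g = "\<lambda>j. position_weight s w i (j, route_index s ?u j)"
  have "set (prefix_route s ?u) = (\<lambda>j. (j, route_index s ?u j)) ` {1..?c}"
    using prefix_route_eq[OF s uv] by (auto simp: atLeastLessThanSuc_atLeastAtMost)
  then have sum: "(\<Sum>e\<in>set (prefix_route s ?u). position_weight s w i e) = (\<Sum>j = 1..?c. ?g j)"
    by (simp add: sum.reindex inj_on_def)
  \<comment> \<open>Below the first open letter the route uses only bumps and dips, and these have
    weight 0 in families below \<open>?a\<close>.\<close>
  have small: "?g j = 0" if "j \<in> {1..length s}" "j < ?c" "j < ?a" for j
    using before_first_open[OF uv that(1,2)] that by (auto simp: position_weight_def route_index_def)
  have big: "?g j = 0" if "?a < j" for j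
    using that by (auto simp: position_weight_def)
  show ?thesis
  proof (cases "?a \<le> ?c")
    case True
    have "(\<Sum>j = 1..?c. ?g j) = (\<Sum>j\<in>{?a}. ?g j)"
    proof (rule sum.mono_neutral_right)
      show "\<forall>j\<in>{1..?c} - {?a}. ?g j = 0"
        using small big True a by (metis DiffE atLeastAtMost_iff less_le_trans insertI1 le_trans linorder_neqE_nat less_imp_le)
    qed (use True a in auto)
    also have "\<dots> = of_bool (count_list (take (Suc i) w) ?a \<le> count_list ?u ?a)"
      using a by (auto simp: position_weight_def route_index_def)
    \<comment> \<open>The letter at position \<open>i\<close> raises the count, so prefixes ending
      before it stay strictly below the threshold.\<close>
    also have "\<dots> = of_bool (i < m)"
    proof (cases "i < m")
      case True
      then show ?thesis using count_list_take_mono[of "Suc i" m w] by simp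
    next
      case False
      have "count_list (take (Suc i) w) ?a = count_list (take i w) ?a + 1"
        using i by (simp add: take_Suc_conv_app_nth)
      then show ?thesis using False count_list_take_mono[of m i w ?a] by simp
    qed
    finally show ?thesis using sum by simp
  next
    case False
    then have c: "?c \<in> {1..length s}" using a first_open_bounds(1)[of s ?u] by auto
    then have o: "0 < count_list ?u ?c" "count_list ?u ?c < part s ?c"
      using first_open_open[of s ?u] by auto
    then have mem: "?c \<in> set ?u" "?c \<in> set ?v" using open_iff[OF uv c] by auto
    have "(\<Sum>j = 1..?c. ?g j) = (\<Sum>j\<in>{?c}. ?g j)"
    proof (rule sum.mono_neutral_right)
      show "\<forall>j\<in>{1..?c} - {?c}. ?g j = 0"
        using small False c by auto
    qed (use c in auto)
    also have "\<dots> = of_bool (?c \<notin> set (take i w))"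
      using o False c by (auto simp: position_weight_def route_index_def)
    \<comment> \<open>The open letter \<open>?c\<close> occurs on both sides of the cut
      \<open>m\<close>. If \<open>i < m\<close>, it occurs behind the larger letter
      \<open>?a\<close>, hence by 121-avoidance not before it.\<close>
    also have "?c \<notin> set (take i w) \<longleftrightarrow> i < m"
    proof
      assume "?c \<notin> set (take i w)"
      then show "i < m"
        using mem(1) set_take_subset_set_take[of m i w] by (meson linorder_not_le subsetD)
    next
      assume "i < m"
      then have "?c \<in> set (drop (Suc i) w)"
        using mem(2) set_drop_subset_set_drop[of "Suc i" m w] by (meson Suc_leI subsetD)
      then show "?c \<notin> set (take i w)"
        using stirling_121[of s "take i w" ?a "drop (Suc i) w" ?c] wi w False by force
    qed
    finally show ?thesis using sum by simp
  qed
qed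

lemma inj_on_prefix_route:
  assumes "composition s" "stirling_perm s w"
  shows "inj_on (\<lambda>m. prefix_route s (take m w)) {..length w}"
proof (rule linorder_inj_onI)
  fix i j assume ij: "i < j" "i \<in> {..length w}" "j \<in> {..length w}"
  then have "(\<Sum>e\<in>set (prefix_route s (take i w)). position_weight s w i e) = 0"
    "(\<Sum>e\<in>set (prefix_route s (take j w)). position_weight s w i e) = 1"
    using position_weight_prefix_route[OF assms, of i i]
      position_weight_prefix_route[OF assms, of i j] by auto
  then show "prefix_route s (take i w) \<noteq> prefix_route s (take j w)" by fastforce
qed auto

lemma Delta_eq_image:
  assumes "stirling_perm s w"
  shows "Delta s w = (\<lambda>m. prefix_route s (take m w)) ` {..length w}"
  unfolding Delta_def using length_stirling[OF assms] by auto

section \<open>Edge weights as linear functionals on flows\<close>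

lemma sum_route_vector:
  fixes lab :: "'e::finite \<Rightarrow> edge"
  assumes "bij_betw lab UNIV (arcs (oruga s))" "set R \<subseteq> arcs (oruga s)"
  shows "(\<Sum>e\<in>UNIV. \<psi> (lab e) * route_vector lab R $ e) = (\<Sum>f\<in>set R. \<psi> f)"
proof -
  have "(\<Sum>e\<in>UNIV. \<psi> (lab e) * route_vector lab R $ e)
    = (\<Sum>f\<in>arcs (oruga s). \<psi> f * (if f \<in> set R then 1 else 0))"
    unfolding route_vector_def
    by (simp only: vec_lambda_beta, rule sum.reindex_bij_betw[OF assms(1)])
  also have "\<dots> = (\<Sum>f\<in>set R. \<psi> f)"
  proof -
    have "finite (arcs (oruga s))" using bij_betw_finite[OF assms(1)] by simp
    then show ?thesis
      using assms(2) by (intro sum.mono_neutral_cong_right) auto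
  qed
  finally show ?thesis .
qed

lemma prefix_route_arcs:
  assumes "composition s" "stirling_perm s (u @ v)"
  shows "set (prefix_route s u) \<subseteq> arcs (oruga s)"
proof -
  let ?c = "first_open s u"
  have "(j, route_index s u j) \<in> arcs (oruga s)" if j: "1 \<le> j" "j \<le> ?c" for j
  proof (cases "j \<le> length s")
    case True
    then show ?thesis
      using before_first_open[OF assms(2), of j] first_open_open[of s u] j
      by (cases "j = ?c") (auto simp: oruga_def route_index_def)
  next
    case False
    then have "j = length s + 1" using j first_open_bounds(2)[of s u] by simp
    then show ?thesis by (simp add: oruga_def route_index_def part_def)
  qed
  then show ?thesis unfolding prefix_route_eq[OF assms] by (auto simp del: upt_Suc)
qed

text \<open>The functionals \<open>\<phi> i\<close> take the triangular values
  \<open>of_bool (i < m)\<close> on the vertices. An affine dependence therefore has vanishing tail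
  sums of coefficients, and consecutive tails differ by one coefficient.\<close>

lemma affine_independent_Delta:
  fixes lab :: "'e::finite \<Rightarrow> edge"
  assumes s: "composition s" and w: "stirling_perm s w"
    and lab: "bij_betw lab UNIV (arcs (oruga s))"
  shows "\<not> affine_dependent (route_vector lab ` Delta s w)"
proof -
  let ?N = "length w"
  define f where "f m = route_vector lab (prefix_route s (take m w))" for m
  define \<phi> where "\<phi> i x = (\<Sum>e\<in>UNIV. position_weight s w i (lab e) * x $ e)"
    for i and x :: "real ^ 'e"
  have \<phi>f: "\<phi> i (f m) = of_bool (i < m)" if "i < ?N" for i m
    unfolding \<phi>_def f_def
    using sum_route_vector[OF lab prefix_route_arcs[OF s, of "take m w" "drop m w"]]
      position_weight_prefix_route[OF s w that] w by simp
  have lin: "\<phi> i (\<Sum>m\<in>A. c m *\<^sub>R f m) = (\<Sum>m\<in>A. c m * \<phi> i (f m))" for i A c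
  proof -
    have "\<phi> i (\<Sum>m\<in>A. c m *\<^sub>R f m)
      = (\<Sum>e\<in>UNIV. \<Sum>m\<in>A. c m * (position_weight s w i (lab e) * f m $ e))"
      unfolding \<phi>_def by (simp add: sum_distrib_left mult_ac)
    also have "\<dots> = (\<Sum>m\<in>A. c m * \<phi> i (f m))"
      unfolding \<phi>_def by (subst sum.swap) (simp add: sum_distrib_left)
    finally show ?thesis .
  qed
  have V: "route_vector lab ` Delta s w = f ` {..?N}"
    unfolding Delta_eq_image[OF w] f_def by auto
  have inj: "inj_on f {..?N}"
  proof (rule linorder_inj_onI)
    fix i j assume ij: "i < j" "i \<in> {..?N}" "j \<in> {..?N}"
    then show "f i \<noteq> f j" using \<phi>f[of i i] \<phi>f[of i j] by auto
  qed auto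
  have coeff: "c m = 0" if c0: "(\<Sum>m\<le>?N. c m) = 0" and c1: "(\<Sum>m\<le>?N. c m *\<^sub>R f m) = 0"
    and m: "m \<le> ?N" for c :: "nat \<Rightarrow> real" and m
  proof -
    have tail: "sum c {i<..?N} = 0" for i
    proof (cases "i < ?N")
      case True
      have "0 = \<phi> i (\<Sum>m\<le>?N. c m *\<^sub>R f m)" unfolding c1 by (simp add: \<phi>_def)
      also have "\<dots> = (\<Sum>m\<le>?N. c m * of_bool (i < m))" using lin \<phi>f[OF True] by simp
      also have "\<dots> = sum c {i<..?N}"
        by (intro sum.mono_neutral_cong_right) auto
      finally show ?thesis by simp
    qed auto
    \<comment> \<open>For \<open>m = 0\<close> there is no functional; the vanishing coefficient sum
      of an affine dependence takes its place.\<close>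
    have "sum c {m..?N} = 0"
    proof (cases m)
      case 0
      then show ?thesis using c0 by (simp add: atLeast0AtMost)
    next
      case (Suc i)
      then show ?thesis using tail[of i] by (simp add: atLeastSucAtMost_greaterThanAtMost)
    qed
    moreover have "{m..?N} = insert m {m<..?N}" using m by auto
    ultimately show ?thesis using tail[of m] by simp
  qed
  have fin: "finite (f ` {..?N})" by simp
  show ?thesis
    unfolding V affine_dependent_explicit_finite[OF fin]
  proof (rule notI, elim exE conjE bexE)
    fix U v
    assume U: "sum U (f ` {..?N}) = 0" "(\<Sum>v\<in>f ` {..?N}. U v *\<^sub>R v) = 0"
      and v: "v \<in> f ` {..?N}" "U v \<noteq> 0"
    obtain m where m: "m \<le> ?N" "v = f m" using v(1) by blast
    have "(\<Sum>m\<le>?N. U (f m)) = 0" "(\<Sum>m\<le>?N. U (f m) *\<^sub>R f m) = 0"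
      using U by (simp_all add: sum.reindex[OF inj])
    then show False using coeff[of "\<lambda>m. U (f m)" m] m v(2) by blast
  qed
qed

subsection \<open>Coherence\<close>

text \<open>Induction on the number of edges. The bound on the vertices strengthens the induction: a
  new edge in front starts at a strictly smaller vertex, so distinctness persists.\<close>

lemma oruga_walk:
  assumes "c \<le> length s" "\<And>j. j \<in> {1..c} \<Longrightarrow> f j = 0 \<or> f j = part s j"
  defines "p \<equiv> map (\<lambda>j. (j, f j)) (rev [1..<Suc c])"
  shows "pre_digraph.cas (oruga s) (int (length s) - int c) p (int (length s))
    \<and> distinct (pre_digraph.awalk_verts (oruga s) (int (length s) - int c) p)
    \<and> (\<forall>x\<in>set (pre_digraph.awalk_verts (oruga s) (int (length s) - int c) p).
        int (length s) - int c \<le> x)"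
  using assms(1,2) unfolding p_def
proof (induction c)
  case 0
  then show ?case by (simp add: pre_digraph.cas.simps pre_digraph.awalk_verts.simps)
next
  case (Suc c)
  have IH: "pre_digraph.cas (oruga s) (int (length s) - int c) (map (\<lambda>j. (j, f j)) (rev [1..<Suc c]))
      (int (length s))
    \<and> distinct (pre_digraph.awalk_verts (oruga s) (int (length s) - int c)
        (map (\<lambda>j. (j, f j)) (rev [1..<Suc c])))
    \<and> (\<forall>x\<in>set (pre_digraph.awalk_verts (oruga s) (int (length s) - int c)
        (map (\<lambda>j. (j, f j)) (rev [1..<Suc c]))). int (length s) - int c \<le> x)"
    using Suc by simp
  have t: "tail (oruga s) (Suc c, f (Suc c)) = int (length s) - int (Suc c)"
    using Suc.prems(2)[of "Suc c"] by (auto simp: oruga_def)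
  have h: "head (oruga s) (Suc c, f (Suc c)) = int (length s) - int c"
    by (simp add: oruga_def)
  have "[1..<Suc (Suc c)] = [1..<Suc c] @ [Suc c]" by simp
  then show ?case
    using IH t h by (force simp: pre_digraph.cas.simps pre_digraph.awalk_verts.simps simp del: upt_Suc)
qed

lemma prefix_route_in_routes:
  assumes "composition s" "stirling_perm s (u @ v)"
  shows "prefix_route s u \<in> routes s"
proof -
  let ?n = "length s" and ?g = "route_index s u"
  obtain c where c: "first_open s u = Suc c" "c \<le> ?n"
    using first_open_bounds[of s u] by (cases "first_open s u") auto
  let ?p = "map (\<lambda>j. (j, ?g j)) (rev [1..<Suc c])"
  have R: "prefix_route s u = (Suc c, ?g (Suc c)) # ?p"
    unfolding prefix_route_eq[OF assms] c(1) by simp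
  have "?g j = 0 \<or> ?g j = part s j" if "j \<in> {1..c}" for j
    using before_first_open[OF assms(2), of j] that c by (auto simp: route_index_def)
  note walk = oruga_walk[OF c(2), of ?g, OF this]
  have h: "head (oruga s) (Suc c, ?g (Suc c)) = int ?n - int c"
    by (simp add: oruga_def)
  \<comment> \<open>An index strictly inside its family belongs to a source edge. The remaining
    vertices are nonnegative because \<open>c \<le> ?n\<close>, so the source is not visited
    again.\<close>
  have "0 < ?g (Suc c) \<and> ?g (Suc c) < part s (Suc c)"
    using first_open_open[of s u] c by (auto simp: route_index_def part_def)
  then have t: "tail (oruga s) (Suc c, ?g (Suc c)) = -1"
    by (simp add: oruga_def)
  have "-1 \<in> verts (oruga s)" by (simp add: oruga_def)
  then show ?thesis
    using walk h t prefix_route_arcs[OF assms] c(2) unfolding R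
    by (fastforce simp: routes_def pre_digraph.apath_def pre_digraph.awalk_def
        pre_digraph.cas.simps pre_digraph.awalk_verts.simps simp del: upt_Suc)
qed

text \<open>A route visits consecutive families in decreasing order, so the edges of two routes entering
  and leaving a common subpath lie in the same families.\<close>

lemma coherent_if_comparable:
  assumes P: "P = map (\<lambda>j. (j, f j)) (rev [1..<Suc c])"
    and Q: "Q = map (\<lambda>j. (j, g j)) (rev [1..<Suc d])"
    and le: "(\<forall>j. f j \<le> g j) \<or> (\<forall>j. g j \<le> f j)"
  shows "coherent s P Q"
  unfolding coherent_def
proof (intro allI impI, elim conjE)
  fix P\<^sub>1 p M p' P\<^sub>2 Q\<^sub>1 q q' Q\<^sub>2
  assume P': "P = P\<^sub>1 @ [p] @ M @ [p'] @ P\<^sub>2" and Q': "Q = Q\<^sub>1 @ [q] @ M @ [q'] @ Q\<^sub>2"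
    and h: "head (oruga s) p = head (oruga s) q" and ne: "p \<noteq> q" "p' \<noteq> q'"
  have nth: "map (\<lambda>j. (j, f j)) (rev [1..<Suc c]) ! i = (c - i, f (c - i))"
    if "i < c" for i c and f :: "nat \<Rightarrow> nat"
    using that by (simp add: rev_nth Suc_diff_Suc del: upt_Suc)
  have *: "p = (c - length P\<^sub>1, f (c - length P\<^sub>1)) \<and>
      p' = (c - length P\<^sub>1 - Suc (length M), f (c - length P\<^sub>1 - Suc (length M)))"
    if e: "map (\<lambda>j. (j, f j)) (rev [1..<Suc c]) = P\<^sub>1 @ [p] @ M @ [p'] @ P\<^sub>2"
    for f :: "nat \<Rightarrow> nat" and c P\<^sub>1 p M p' P\<^sub>2
  proof -
    have l: "length P\<^sub>1 + Suc (length M) < c"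
      using arg_cong[OF e, of length] by (simp del: upt_Suc)
    have "p = map (\<lambda>j. (j, f j)) (rev [1..<Suc c]) ! length P\<^sub>1" unfolding e by simp
    also have "\<dots> = (c - length P\<^sub>1, f (c - length P\<^sub>1))" by (rule nth) (use l in linarith)
    finally have p: "p = (c - length P\<^sub>1, f (c - length P\<^sub>1))" .
    have "p' = map (\<lambda>j. (j, f j)) (rev [1..<Suc c]) ! (length P\<^sub>1 + Suc (length M))"
      unfolding e by (simp add: nth_append)
    also have "\<dots> = (c - (length P\<^sub>1 + Suc (length M)), f (c - (length P\<^sub>1 + Suc (length M))))"
      by (rule nth[OF l])
    finally show ?thesis using p by simp
  qed
  define k where "k = c - length P\<^sub>1"
  define k' where "k' = k - Suc (length M)"
  have p: "p = (k, f k)" "p' = (k', f k')"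
    using *[OF P'[unfolded P]] by (simp_all add: k_def k'_def)
  \<comment> \<open>The head determines the family, so both routes enter the common subpath in
    family \<open>k\<close>; as \<open>M\<close> is the same list, they also leave it in one family
    \<open>k'\<close>.\<close>
  moreover have "fst q = k" using h p by (simp add: oruga_def split: prod.splits)
  ultimately have "q = (k, g k)" "q' = (k', g k')"
    using *[OF Q'[unfolded Q]] by (auto simp: k'_def)
  moreover have "f k \<le> g k \<and> f k' \<le> g k' \<or> g k \<le> f k \<and> g k' \<le> f k'" using le by blast
  ultimately show "framing_less p q \<longleftrightarrow> framing_less p' q'"
    using p ne by (auto simp: framing_less_def)
qed

lemma coherent_Delta:
  assumes s: "composition s" and w: "stirling_perm s w"
    and "P \<in> Delta s w" "Q \<in> Delta s w"
  shows "coherent s P Q"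
proof -
  obtain i j where P: "P = prefix_route s (take i w)" and Q: "Q = prefix_route s (take j w)"
    using assms by (auto simp: Delta_def)
  have eq: "prefix_route s (take m w) = map (\<lambda>j. (j, route_index s (take m w) j))
      (rev [1..<Suc (first_open s (take m w))])" for m
    using prefix_route_eq[OF s, of "take m w" "drop m w"] w by (simp del: upt_Suc)
  have "(\<forall>a. route_index s (take i w) a \<le> route_index s (take j w) a) \<or>
    (\<forall>a. route_index s (take j w) a \<le> route_index s (take i w) a)"
    using count_list_take_mono[of i j w] count_list_take_mono[of j i w] nat_le_linear[of i j]
    by (auto simp: route_index_def)
  then show ?thesis
    unfolding P Q by (rule coherent_if_comparable[OF eq eq])
qed

lemma Delta_simplex_in_triangulation:
  assumes "composition s" "stirling_perm s w"
  shows "route_simplex lab (Delta s w) \<in> dkk_triangulation s lab"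
proof -
  have "Delta s w \<subseteq> routes s"
    using prefix_route_in_routes[OF assms(1)] assms(2) unfolding Delta_eq[OF assms(2)] by blast
  moreover have "\<forall>P\<in>Delta s w. \<forall>Q\<in>Delta s w. coherent s P Q"
    using coherent_Delta[OF assms] by blast
  ultimately show ?thesis
    unfolding dkk_triangulation_def by (intro CollectI exI[of _ "Delta s w"] conjI refl)
qed

section \<open>Simplices sharing a facet\<close>

lemma convex_hull_eq_iff_affine_independent:
  fixes V W :: "'a::euclidean_space set"
  assumes "\<not> affine_dependent V" "\<not> affine_dependent W"
  shows "convex hull V = convex hull W \<longleftrightarrow> V = W"
  using extreme_point_of_convex_hull_affine_independent[OF assms(1)]
    extreme_point_of_convex_hull_affine_independent[OF assms(2)] by auto

text \<open>A facet of a simplex is the hull of all vertices but one, and an affinely independent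
  set is recovered from its hull as the set of extreme points.\<close>

lemma common_facet_iff:
  fixes V W :: "'a::euclidean_space set"
  assumes V: "\<not> affine_dependent V" and W: "\<not> affine_dependent W" and VW: "V \<inter> W \<noteq> {}"
  shows "convex hull V \<noteq> convex hull W \<and>
      (\<exists>F. F facet_of convex hull V \<and> F facet_of convex hull W) \<longleftrightarrow>
    card (V - W) = 1 \<and> card (W - V) = 1" (is "?L \<longleftrightarrow> ?R")
proof
  assume ?L
  then obtain F where F: "F facet_of convex hull V" "F facet_of convex hull W" and ne: "V \<noteq> W"
    by blast
  obtain v where "v \<in> V" "F = convex hull (V - {v})"
    using F(1) unfolding facet_of_convex_hull_affine_independent[OF V] by blast
  moreover obtain u where "u \<in> W" "F = convex hull (W - {u})"
    using F(2) unfolding facet_of_convex_hull_affine_independent[OF W] by blast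
  ultimately have v: "v \<in> V" "u \<in> W" "convex hull (V - {v}) = convex hull (W - {u})" by auto
  have "V - {v} = W - {u}"
    using v(3) convex_hull_eq_iff_affine_independent affine_independent_Diff[OF V]
      affine_independent_Diff[OF W] by metis
  then have "V - W = {v}" "W - V = {u}" using v ne by blast+
  then show ?R by simp
next
  assume ?R
  then obtain v u where vu: "V - W = {v}" "W - V = {u}" by (metis card_1_singletonE)
  \<comment> \<open>Facets are nonempty by definition; the common vertex guarantees this.\<close>
  have ne: "convex hull (V \<inter> W) \<noteq> {}" using VW by simp
  have "v \<in> V" "V \<inter> W = V - {v}" "u \<in> W" "V \<inter> W = W - {u}" using vu by auto
  then have "convex hull (V \<inter> W) facet_of convex hull V" "convex hull (V \<inter> W) facet_of convex hull W"
    unfolding facet_of_convex_hull_affine_independent[OF V]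
      facet_of_convex_hull_affine_independent[OF W] using ne by metis+
  moreover have "convex hull V \<noteq> convex hull W"
    using convex_hull_eq_iff_affine_independent[OF V W] vu by blast
  ultimately show ?L by blast
qed

text \<open>A route vector determines the set of edges. This set contains exactly one edge of each
  family up to the first open letter, so it determines the list.\<close>

lemma inj_on_route_vector:
  fixes lab :: "'e::finite \<Rightarrow> edge"
  assumes s: "composition s" and w: "stirling_perm s w" and w': "stirling_perm s w'"
    and lab: "bij_betw lab UNIV (arcs (oruga s))"
  shows "inj_on (route_vector lab) (Delta s w \<union> Delta s w')"
proof (rule inj_onI)
  fix P Q assume PQ: "P \<in> Delta s w \<union> Delta s w'" "Q \<in> Delta s w \<union> Delta s w'"
    and e: "route_vector lab P = route_vector lab Q"
  have ex: "\<exists>u v. P = prefix_route s u \<and> stirling_perm s (u @ v)"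
    if "stirling_perm s x" "P \<in> Delta s x" for x P
    using that(2) that(1) unfolding Delta_eq[OF that(1)] by blast
  obtain u v u' v' where P: "P = prefix_route s u" "stirling_perm s (u @ v)"
    and Q: "Q = prefix_route s u'" "stirling_perm s (u' @ v')"
    using PQ ex[OF w] ex[OF w'] by blast
  have "lab x \<in> set P \<longleftrightarrow> lab x \<in> set Q" for x
    using arg_cong[OF e, of "\<lambda>y. y $ x"] by (simp add: route_vector_def split: if_splits)
  moreover have "set P \<subseteq> range lab" "set Q \<subseteq> range lab"
    using prefix_route_arcs[OF s] P Q lab by (auto simp: bij_betw_def)
  ultimately have "set P = set Q" by blast
  then have img: "(\<lambda>j. (j, route_index s u j)) ` {1..first_open s u}
      = (\<lambda>j. (j, route_index s u' j)) ` {1..first_open s u'}"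
    unfolding P(1) Q(1) prefix_route_eq[OF s P(2)] prefix_route_eq[OF s Q(2)]
    by (simp add: atLeastLessThanSuc_atLeastAtMost del: upt_Suc)
  have "{1..first_open s u} = {1..first_open s u'}"
    using arg_cong[OF img, of "image fst"] by (simp add: image_image)
  then have c: "first_open s u = first_open s u'"
    using first_open_bounds(1)[of s u] first_open_bounds(1)[of s u'] by auto
  then have "route_index s u j = route_index s u' j" if "1 \<le> j" "j \<le> first_open s u" for j
    using img that by force
  then show "P = Q"
    unfolding P(1) Q(1) prefix_route_eq[OF s P(2)] prefix_route_eq[OF s Q(2)] c
    by (auto simp: c)
qed

lemma adjacent_in_iff_card:
  fixes lab :: "'e::finite \<Rightarrow> edge"
  assumes s: "composition s" and w: "stirling_perm s w" and w': "stirling_perm s w'"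
    and lab: "bij_betw lab UNIV (arcs (oruga s))"
  shows "adjacent_in (dkk_triangulation s lab)
      (route_simplex lab (Delta s w)) (route_simplex lab (Delta s w')) \<longleftrightarrow>
    card (Delta s w - Delta s w') = 1 \<and> card (Delta s w' - Delta s w) = 1"
proof -
  let ?f = "route_vector lab"
  let ?V = "?f ` Delta s w" and ?W = "?f ` Delta s w'"
  note inj = inj_on_route_vector[OF s w w' lab]
  have "?V - ?W = ?f ` (Delta s w - Delta s w')" "?W - ?V = ?f ` (Delta s w' - Delta s w)"
    using inj by (auto simp: inj_on_def)
  then have "card (?V - ?W) = card (Delta s w - Delta s w')"
    "card (?W - ?V) = card (Delta s w' - Delta s w)"
    using inj by (auto intro!: card_image inj_on_subset[OF inj])
  \<comment> \<open>The empty prefix supplies the common vertex required by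
    \<open>common_facet_iff\<close>.\<close>
  moreover have "prefix_route s [] \<in> Delta s w \<inter> Delta s w'"
    unfolding Delta_def by (auto intro!: exI[of _ 0])
  then have "?V \<inter> ?W \<noteq> {}" by blast
  ultimately show ?thesis
    using common_facet_iff[OF affine_independent_Delta[OF s w lab] affine_independent_Delta[OF s w' lab]]
      Delta_simplex_in_triangulation[OF s w] Delta_simplex_in_triangulation[OF s w']
    unfolding adjacent_in_def route_simplex_def by auto
qed

section \<open>Inversions and first differences\<close>

lemma inversions_eq:
  "a \<in> set w \<Longrightarrow> inversions w c a = count_list (takeWhile (\<lambda>x. x \<noteq> a) w) c"
  by (simp add: inversions_def before_block_eq_takeWhile)

lemma inversions_first:
  "a \<notin> set p \<Longrightarrow> inversions (p @ a # r) c a = count_list p c"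
  by (subst inversions_eq) (auto simp: takeWhile_append)

lemma inversions_ge:
  assumes "a \<notin> set p" "a \<in> set r"
  shows "count_list p c \<le> inversions (p @ r) c a"
  using assms by (subst inversions_eq) (auto simp: takeWhile_append)

lemma inversions_le:
  assumes "a \<in> set p"
  shows "inversions (p @ r) c a \<le> count_list p c"
proof -
  obtain p1 p2 where p: "p = p1 @ a # p2" "a \<notin> set p1" using split_list_first[OF assms] by blast
  then show ?thesis using inversions_first[of a p1 "p2 @ r" c] by simp
qed

section \<open>Two Stirling permutations at their first difference\<close>

lemma first_difference:
  assumes s: "composition s" and w: "stirling_perm s w" and w': "stirling_perm s w'"
    and ne: "w \<noteq> w'"
  obtains u x v y v' where "w = u @ x # v" "w' = u @ y # v'" "x \<noteq> y"
proof -
  have "length w = length w'" using length_stirling w w' by metis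
  then show thesis using same_length_different[OF ne] that by (metis append_Cons append_Nil)
qed

lemma rest_has_letter:
  assumes "stirling_perm s (u @ v)" "stirling_perm s (u @ v')" "b \<in> {1..length s}"
  shows "b \<in> set v \<longleftrightarrow> b \<in> set v'"
proof -
  have "count_list v b = count_list v' b"
    using count_list_stirling[OF assms(1,3)] count_list_stirling[OF assms(2,3)] by simp
  then show ?thesis by (metis count_list_0_iff)
qed

text \<open>Both words have the same letters left after \<open>u\<close>, so \<open>b\<close> occurs
  behind \<open>y\<close> in the second word; a \<open>b\<close> in \<open>u\<close> would complete
  a 121 pattern.\<close>

lemma not_in_common_prefix:
  assumes "composition s" "stirling_perm s (u @ v)" "stirling_perm s (u @ y # v')"
    and "b \<in> set v" "b < y"
  shows "b \<notin> set u"
proof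
  assume b: "b \<in> set u"
  have "b \<in> {1..length s}" using set_stirling[OF assms(1,2)] assms(4) by auto
  then have "b \<in> set (y # v')" using rest_has_letter[OF assms(2,3)] assms(4) by blast
  then show False using stirling_121[OF assms(3) assms(5) b] assms(5) by auto
qed

lemma next_occurrence:
  assumes s: "composition s" and w: "stirling_perm s (u @ x # v)"
    and w': "stirling_perm s (u @ y # v')" and "x \<noteq> y"
  obtains q r where "v = q @ y # r" "y \<notin> set (x # q)"
proof -
  have "y \<in> {1..length s}" using set_stirling[OF s w'] by auto
  then have "y \<in> set v" using rest_has_letter[OF w w'] assms(4) by auto
  then show thesis using split_list_first[of y v] assms(4) that by auto
qed

lemma prefix_of_append:
  assumes "u @ v = p @ r"
  shows "(\<exists>t. u = p @ t \<and> r = t @ v) \<or> (\<exists>t. p = u @ t \<and> v = t @ r)"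
  using assms by (auto simp: append_eq_append_conv2)

section \<open>Routes that separate two words\<close>

lemma count_list_eq_of_prefix_route_eq:
  assumes "composition s" "stirling_perm s (u @ v)" "stirling_perm s (p @ r)"
    and "prefix_route s u = prefix_route s p" "j \<in> {1..length s}" "j \<le> first_open s u"
  shows "count_list u j = count_list p j"
  using prefix_route_eq_iff[OF assms(1-3)] assms(4-6) by blast

text \<open>A prefix of the second word containing as many letters \<open>y\<close> as the first word has before its
  next \<open>y\<close> does not yet contain the letter \<open>x\<close> in question.\<close>

lemma route_not_in_upper:
  assumes s: "composition s" and w: "stirling_perm s (u @ (x # q) @ r)"
    and w': "stirling_perm s (u @ y # v')" and xy: "x < y" "y \<notin> set q"
    and c: "y \<le> first_open s (u @ x # q)"
  shows "prefix_route s (u @ x # q) \<notin> Delta s (u @ y # v')"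
proof
  assume "prefix_route s (u @ x # q) \<in> Delta s (u @ y # v')"
  then obtain p p' where p: "u @ y # v' = p @ p'" "prefix_route s (u @ x # q) = prefix_route s p"
    unfolding Delta_eq[OF w'] by auto
  have "y \<in> {1..length s}" "x \<in> {1..length s}"
    using set_stirling[OF s w'] set_stirling[OF s w] by auto
  moreover have "stirling_perm s ((u @ x # q) @ r)" "stirling_perm s (p @ p')" using w w' p by auto
  note eq = count_list_eq_of_prefix_route_eq[OF s this p(2)]
  ultimately have e: "count_list (u @ x # q) y = count_list p y"
    "count_list (u @ x # q) x = count_list p x"
    using eq[of y] eq[of x] c xy(1) by linarith+
  have "count_list q y = 0" using xy(2) by (simp add: count_list_0_iff)
  then have y: "count_list p y = count_list u y" using e(1) xy(1) by simp
  from prefix_of_append[OF p(1)] show False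
  proof (elim disjE exE conjE)
    fix t assume "u = p @ t"
    then show False using e(2) by simp
  next
    fix t assume t: "p = u @ t" "y # v' = t @ p'"
    then show False using y e(2) by (cases t) auto
  qed
qed

text \<open>To reach one more \<open>y\<close> than \<open>u\<close> has, a prefix of the lower word
  must pass the \<open>x\<close> behind \<open>u\<close>. It then has too many letters
  \<open>x\<close>, and the route shows this because \<open>x < y\<close>.\<close>

lemma route_not_in_lower:
  assumes s: "composition s" and w: "stirling_perm s (u @ x # v)"
    and w': "stirling_perm s (u @ y # v')" and xy: "x < y"
  shows "prefix_route s (u @ [y]) \<notin> Delta s (u @ x # v)"
proof
  assume "prefix_route s (u @ [y]) \<in> Delta s (u @ x # v)"
  then obtain p p' where p: "u @ x # v = p @ p'" "prefix_route s (u @ [y]) = prefix_route s p"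
    unfolding Delta_eq[OF w] by auto
  have "y \<in> {1..length s}" "x \<in> {1..length s}"
    using set_stirling[OF s w'] set_stirling[OF s w] by auto
  moreover have "stirling_perm s ((u @ [y]) @ v')" "stirling_perm s (p @ p')" using w w' p by auto
  note eq = count_list_eq_of_prefix_route_eq[OF s this p(2)]
  ultimately have e: "count_list (u @ [y]) y = count_list p y"
    "count_list (u @ [y]) x = count_list p x"
    using eq[of y] eq[of x] xy last_le_first_open[OF s w'] by linarith+
  from prefix_of_append[OF p(1)] show False
  proof (elim disjE exE conjE)
    fix t assume "u = p @ t"
    then show False using e(1) by simp
  next
    fix t assume t: "p = u @ t" "x # v = t @ p'"
    then show False using e xy by (cases t) auto
  qed
qed

lemma Delta_prefixI: "stirling_perm s (u @ v) \<Longrightarrow> prefix_route s u \<in> Delta s (u @ v)"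
  using Delta_eq by blast

lemma Delta_ne:
  assumes s: "composition s" and w: "stirling_perm s (u @ x # v)"
    and w': "stirling_perm s (u @ y # v')" and xy: "x < y"
  shows "Delta s (u @ x # v) \<noteq> Delta s (u @ y # v')"
proof
  assume "Delta s (u @ x # v) = Delta s (u @ y # v')"
  moreover have "prefix_route s (u @ [y]) \<in> Delta s (u @ y # v')"
    using Delta_prefixI[of s "u @ [y]" v'] w' by simp
  ultimately show False using route_not_in_lower[OF s w w' xy] by simp
qed

lemma Delta_inject:
  assumes s: "composition s" and w: "stirling_perm s w" and w': "stirling_perm s w'"
    and e: "Delta s w = Delta s w'"
  shows "w = w'"
proof (rule ccontr)
  assume "w \<noteq> w'"
  then obtain u x v y v' where d: "w = u @ x # v" "w' = u @ y # v'" "x \<noteq> y"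
    using first_difference[OF s w w'] by blast
  then show False
    using Delta_ne[OF s, of u x v y v'] Delta_ne[OF s, of u y v' x v] w w' e
    by (cases x y rule: linorder_cases) auto
qed

section \<open>Antisymmetry of the weak order\<close>

text \<open>The letter \<open>x\<close> does not occur in \<open>u\<close>. Its block starts right
  after \<open>u\<close> in the first word, but only behind a further \<open>y\<close> in the
  second.\<close>

lemma inversions_first_difference:
  assumes s: "composition s" and w: "stirling_perm s (u @ x # v)"
    and w': "stirling_perm s (u @ y # v')" and xy: "x < y"
  shows "inversions (u @ x # v) y x < inversions (u @ y # v') y x"
proof -
  have xu: "x \<notin> set u" using not_in_common_prefix[OF s w w'] xy by simp
  have "x \<in> {1..length s}" using set_stirling[OF s w] by auto
  then have "x \<in> set v'" using rest_has_letter[OF w w'] xy by auto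
  then show ?thesis
    using inversions_first[OF xu, of v y] inversions_ge[of x "u @ [y]" v' y] xu xy by simp
qed

lemma weak_le_first_difference:
  assumes s: "composition s" and w: "stirling_perm s (u @ x # v)"
    and w': "stirling_perm s (u @ y # v')" and ne: "x \<noteq> y"
    and le: "weak_le s (u @ x # v) (u @ y # v')"
  shows "x < y"
proof (rule ccontr)
  assume "\<not> x < y"
  then have yx: "y < x" using ne by simp
  have "1 \<le> y" "x \<le> length s" using set_stirling[OF s w] set_stirling[OF s w'] by auto
  then show False
    using inversions_first_difference[OF s w' w yx] le yx unfolding weak_le_def
    by (meson linorder_not_le)
qed

lemma weak_le_antisym:
  assumes s: "composition s" and w: "stirling_perm s w" and w': "stirling_perm s w'"
    and le: "weak_le s w w'" "weak_le s w' w"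
  shows "w = w'"
proof (rule ccontr)
  assume "w \<noteq> w'"
  then obtain u x v y v' where d: "w = u @ x # v" "w' = u @ y # v'" "x \<noteq> y"
    using first_difference[OF s w w'] by blast
  then show False
    using weak_le_first_difference[OF s, of u x v y v'] weak_le_first_difference[OF s, of u y v' x v]
      w w' le by auto
qed

section \<open>Moving a letter across a block\<close>

text \<open>The conditions make \<open>B\<close> the whole block of \<open>hd B\<close>: no
  occurrence precedes it, and one in \<open>v\<close> would form a 121 pattern around
  \<open>y\<close>.\<close>

locale block_move =
  fixes s u B y v
  assumes s: "composition s" and w: "stirling_perm s (u @ B @ y # v)"
    and B: "B \<noteq> []" "hd B = last B" "hd B < y" "hd B \<notin> set u"
begin

text \<open>A larger letter would lie between the two equal ends of \<open>B\<close>.\<close>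

lemma le_hd:
  assumes "a \<in> set B"
  shows "a \<le> hd B"
proof (rule ccontr)
  assume a: "\<not> a \<le> hd B"
  obtain B1 B2 where B12: "B = B1 @ a # B2" using split_list[OF assms] by blast
  have "B1 \<noteq> []" "B2 \<noteq> []" using a B12 B by auto
  then have "hd B \<in> set B1" "last B \<in> set B2" using B12 by auto
  then show False
    using stirling_121[of s "u @ B1" a "B2 @ y # v" "hd B"] w a B12 B(2) by auto
qed

lemma less_y: "a \<in> set B \<Longrightarrow> a < y"
  using le_hd B(3) by fastforce

text \<open>A letter of \<open>B\<close> other than \<open>hd B\<close> is smaller than
  \<open>hd B\<close>, so an occurrence in \<open>u\<close> would enclose the first letter of
  \<open>B\<close>.\<close>

lemma not_before:
  assumes "a \<in> set B"
  shows "a \<notin> set u"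
proof (cases "a = hd B")
  case True
  then show ?thesis using B by simp
next
  case False
  obtain B' where B': "B = hd B # B'" using B(1) by (cases B) auto
  have "a \<in> set B'" "a < hd B" using assms False B' le_hd by (auto simp: order_less_le) (metis set_ConsD)
  then show ?thesis
    using stirling_121[of s u "hd B" "B' @ y # v" a] w B' by (metis Un_iff append_Cons set_append)
qed

text \<open>Cases on the middle letter \<open>c\<close> of a pattern. In \<open>u\<close> or
  \<open>v\<close>, the same letters surround it as in the old word. At the moved \<open>y\<close>,
  \<open>not_before\<close> puts the last letter of the pattern into \<open>v\<close>, which the old
  word forbids. Inside \<open>B\<close>, \<open>c\<close> is below \<open>y\<close>, so
  \<open>y\<close> is not an outer letter and the pattern is an old one.\<close>

lemma stirling_moved: "stirling_perm s (u @ y # B @ v)"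
proof -
  have "avoids_121 (u @ y # B @ v)"
    unfolding avoids_121_iff
  proof (intro allI impI, elim conjE, rule ccontr)
    fix g c h a
    assume e: "u @ y # B @ v = g @ c # h" and ac: "a < c" and "\<not> (a \<notin> set g \<or> a \<notin> set h)"
    then have a: "a \<in> set g" "a \<in> set h" by auto
    from append_eq_append_Cons_cases[OF e] show False
    proof (elim disjE exE conjE)
      fix t assume "u = g @ c # t" "h = t @ y # B @ v"
      then show False using stirling_121[of s g c "t @ B @ y # v" a] w a ac by auto
    next
      fix t assume t: "g = u @ t" "y # B @ v = t @ c # h"
      show False
      proof (cases t)
        case Nil
        then have "c = y" "h = B @ v" "g = u" using t by auto
        then show False
          using a ac not_before[of a] stirling_121[of s "u @ B" y v a] w by auto
      next
        case (Cons y' t')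
        then have t': "g = u @ y # t'" "B @ v = t' @ c # h" using t by auto
        from append_eq_append_Cons_cases[OF t'(2)] show False
        proof (elim disjE exE conjE)
          fix t2 assume t2: "B = t' @ c # t2" "h = t2 @ v"
          have "a \<noteq> y" using less_y[of c] t2 ac by auto
          then show False
            using stirling_121[of s "u @ t'" c "t2 @ y # v" a] w a ac t2 t'(1) by auto
        next
          fix t2 assume t2: "t' = B @ t2" "v = t2 @ c # h"
          then show False
            using stirling_121[of s "u @ B @ y # t2" c h a] w a ac t'(1) by auto
        qed
      qed
    qed
  qed
  moreover have "mset (u @ y # B @ v) = mset (u @ B @ y # v)" by simp
  ultimately show ?thesis using w unfolding stirling_perm_def by presburger
qed

lemma inversions_moved:
  assumes a: "1 \<le> a" "a < c" "c \<le> length s"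
  shows "inversions (u @ y # B @ v) c a
    = inversions (u @ B @ y # v) c a + (if c = y \<and> a \<in> set B then 1 else 0)"
proof -
  have "a \<in> set (u @ B @ y # v)" "a \<in> set (u @ y # B @ v)"
    using set_stirling[OF s w] set_stirling[OF s stirling_moved] a by auto
  note inv = inversions_eq[OF this(1)] inversions_eq[OF this(2)]
  \<comment> \<open>Moving \<open>y\<close> may take \<open>B\<close> out of the part before the
    block of \<open>y\<close>, but \<open>B\<close> contains no letter above
    \<open>y\<close>.\<close>
  have "count_list B c = 0" if "a = y"
    using that a less_y by (fastforce simp: count_list_0_iff)
  then show ?thesis
    unfolding inv using not_before[of a] less_y[of a] by (auto simp: takeWhile_append)
qed

lemma weak_le_moved: "weak_le s (u @ B @ y # v) (u @ y # B @ v)"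
  unfolding weak_le_def using inversions_moved by auto

lemma moved_ne: "u @ B @ y # v \<noteq> u @ y # B @ v"
  using B less_y[of "hd B"] by (cases B) auto

text \<open>The block of \<open>a\<close> starts strictly between the two ends of \<open>B\<close>,
  both of which are \<open>hd B\<close>. This supplies the hypotheses of the next lemma.\<close>

lemma inversions_hd_block:
  assumes a: "a \<in> set B" "a \<noteq> hd B"
  shows "0 < inversions (u @ B @ y # v) (hd B) a"
    "inversions (u @ B @ y # v) (hd B) a < part s (hd B)"
proof -
  let ?b = "hd B"
  obtain B' where B': "B = ?b # B'" using B(1) by (cases B) auto
  have "a \<in> set (B' @ y # v)" using a B' by (metis UnI1 set_ConsD set_append)
  moreover have "a \<notin> set (u @ [?b])" using not_before a by auto
  ultimately have "count_list (u @ [?b]) ?b \<le> inversions ((u @ [?b]) @ (B' @ y # v)) ?b a"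
    by (intro inversions_ge)
  moreover have e: "(u @ [?b]) @ (B' @ y # v) = u @ B @ y # v"
    using B' by (metis append.assoc append_Cons append_Nil)
  ultimately have "count_list (u @ [?b]) ?b \<le> inversions (u @ B @ y # v) ?b a"
    by (simp only: e)
  then show "0 < inversions (u @ B @ y # v) ?b a" by simp
  obtain B0 where B0: "B = B0 @ [?b]" using B(1,2) by (metis append_butlast_last_id)
  have "a \<in> set (u @ B0)" using a B0 by (metis Un_iff empty_iff empty_set set_ConsD set_append)
  then have "inversions ((u @ B0) @ (?b # y # v)) ?b a \<le> count_list (u @ B0) ?b"
    by (intro inversions_le)
  moreover have e: "(u @ B0) @ (?b # y # v) = u @ B @ y # v"
    using B0 by (metis append.assoc append_Cons append_Nil)
  moreover have "count_list (u @ B0) ?b < part s ?b"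
  proof -
    have "?b \<in> {1..length s}" unfolding set_stirling[OF s w, symmetric] using B(1) by simp
    then have "part s ?b = count_list ((u @ B0) @ (?b # y # v)) ?b"
      unfolding e using count_list_stirling[OF w] by simp
    then show ?thesis by simp
  qed
  ultimately show "inversions (u @ B @ y # v) ?b a < part s ?b" by (metis order.strict_trans1)
qed

end

text \<open>If some but not all letters \<open>b\<close> precede the block of \<open>a\<close>, then this block lies inside the
  block of \<open>b\<close>, which contains no letter above \<open>b\<close>.\<close>

lemma inversions_eq_inside_block:
  assumes s: "composition s" and w: "stirling_perm s w"
    and abc: "1 \<le> a" "a < b" "b < c" "c \<le> length s"
    and o: "0 < inversions w b a" "inversions w b a < part s b"
  shows "inversions w c a = inversions w c b"
proof -
  have "a \<in> set w" using set_stirling[OF s w] abc by auto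
  then obtain p r where pr: "w = p @ a # r" "a \<notin> set p" using split_list_first by metis
  have b: "b \<in> {1..length s}" using abc by auto
  have "inversions w b a = count_list p b" using inversions_first pr by simp
  then have "b \<in> set p" "b \<in> set (a # r)" using o open_iff[of s p "a # r" b] w pr(1) b by auto
  moreover from this obtain p1 p2 where p: "p = p1 @ b # p2" "b \<notin> set p1"
    using split_list_first by metis
  moreover have "c \<notin> set p2"
  proof
    assume "c \<in> set p2"
    then obtain p3 p4 where "p2 = p3 @ c # p4" using split_list by metis
    then show False
      using stirling_121[of s "p1 @ b # p3" c "p4 @ a # r" b] w pr p \<open>b \<in> set (a # r)\<close> abc by auto
  qed
  then have "count_list p c = count_list p1 c" using p abc by (simp add: count_list_0_iff)
  then show ?thesis
    using inversions_first[OF pr(2), of r c] inversions_first[OF p(2), of "p2 @ a # r" c] pr p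
    by simp
qed

section \<open>The move is a cover and exchanges one route\<close>

context block_move
begin

text \<open>A word \<open>x\<close> between the two can exceed the lower one only in the pairs of
  \<open>y\<close> with a letter of \<open>B\<close>, by at most one each. These inversions are all
  tied to the one for \<open>hd B\<close>, so they change together and antisymmetry identifies
  \<open>x\<close> with an end.\<close>

lemma covered: "weak_covered s (u @ B @ y # v) (u @ y # B @ v)"
proof -
  let ?w = "u @ B @ y # v" and ?w' = "u @ y # B @ v" and ?b = "hd B"
  have b: "?b \<in> set B" using B(1) by simp
  have "?b \<in> {1..length s}" "y \<in> {1..length s}"
    unfolding set_stirling[OF s w, symmetric] using b by auto
  then have y: "y \<le> length s" and b1: "1 \<le> ?b" by auto
  have "x = ?w \<or> x = ?w'"
    if x: "stirling_perm s x" and le: "weak_le s ?w x" "weak_le s x ?w'" for x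
  proof -
    have bounds: "inversions ?w c a \<le> inversions x c a \<and> inversions x c a \<le> inversions ?w c a
        + (if c = y \<and> a \<in> set B then 1 else 0)" if "1 \<le> a" "a < c" "c \<le> length s" for a c
      using le inversions_moved[OF that] that unfolding weak_le_def by metis
    have same: "inversions x y a = inversions x y ?b \<and> inversions ?w y a = inversions ?w y ?b"
      if a: "1 \<le> a" "a \<in> set B" for a
    proof (cases "a = ?b")
      case False
      have ab: "a < ?b" using le_hd[OF a(2)] False by simp
      \<comment> \<open>The move does not affect this pair, so the bounds pinch. Hence also in
        \<open>x\<close> the block of \<open>a\<close> lies inside the block of
        \<open>?b\<close>.\<close>
      have "inversions x ?b a = inversions ?w ?b a"
        using bounds[of a ?b] a ab B(3) y by simp
      then show ?thesis
        using inversions_hd_block[OF a(2) False] inversions_eq_inside_block[OF s w a(1) ab B(3) y]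
          inversions_eq_inside_block[OF s x a(1) ab B(3) y] by simp
    qed simp
    show ?thesis
    proof (cases "inversions x y ?b = inversions ?w y ?b")
      case True
      have "weak_le s x ?w"
        unfolding weak_le_def
      proof (intro allI impI, elim conjE)
        fix a c assume a: "1 \<le> a" "a < c" "c \<le> length s"
        show "inversions x c a \<le> inversions ?w c a"
          using bounds[OF a] same[OF a(1)] True by (cases "c = y \<and> a \<in> set B") auto
      qed
      then show ?thesis using weak_le_antisym[OF s x w] le by blast
    next
      case False
      then have step: "inversions x y ?b = inversions ?w y ?b + 1"
        using bounds[of ?b y] b b1 B(3) y by simp
      have "weak_le s ?w' x"
        unfolding weak_le_def
      proof (intro allI impI, elim conjE)
        fix a c assume a: "1 \<le> a" "a < c" "c \<le> length s"
        show "inversions ?w' c a \<le> inversions x c a"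
          using bounds[OF a] same[OF a(1)] inversions_moved[OF a] step
          by (cases "c = y \<and> a \<in> set B") auto
      qed
      then show ?thesis using weak_le_antisym[OF s x stirling_moved] le by blast
    qed
  qed
  then show ?thesis
    using w stirling_moved weak_le_moved moved_ne
    unfolding weak_covered_def weak_less_def by blast
qed

lemma prefix_route_inside_block:
  assumes "B = B1 @ B2" "B1 \<noteq> []" "B2 \<noteq> []"
  shows "prefix_route s (u @ B1) = prefix_route s (u @ y # B1)"
proof -
  let ?b = "hd B"
  have w1: "stirling_perm s ((u @ B1) @ B2 @ y # v)"
    and w2: "stirling_perm s ((u @ y # B1) @ B2 @ v)"
    using w stirling_moved assms(1) by auto
  have "hd B \<in> set B1" "last B \<in> set B2" using assms by simp_all
  moreover have "?b \<in> {1..length s}" unfolding set_stirling[OF s w, symmetric] using B(1) by simp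
  ultimately have b: "?b \<in> {1..length s}" "?b \<in> set B1" "?b \<in> set B2" using B(2) by auto
  \<comment> \<open>The letter \<open>?b\<close> is open in both prefixes, so neither route reaches
    family \<open>y\<close>, the only one where the counts differ.\<close>
  have le: "first_open s (u @ B1) \<le> ?b" "first_open s (u @ y # B1) \<le> ?b"
    using open_iff[OF w1 b(1)] open_iff[OF w2 b(1)] b first_open_le[OF b(1)] by auto
  have c: "count_list (u @ B1) j = count_list (u @ y # B1) j" if "j \<noteq> y" for j
    using that by simp
  have "first_open s (u @ B1) \<le> length s" "first_open s (u @ y # B1) \<le> length s"
    "first_open s (u @ B1) \<noteq> y" "first_open s (u @ y # B1) \<noteq> y"
    using le b(1) B(3) by auto
  then have "first_open s (u @ B1) = first_open s (u @ y # B1)"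
    using first_open_open c first_open_le first_open_bounds(1)
    by (metis atLeastAtMost_iff order_antisym)
  moreover have "count_list (u @ B1) j = count_list (u @ y # B1) j"
    if "j \<le> first_open s (u @ B1)" for j
    using c[of j] that le B(3) by linarith
  ultimately show ?thesis
    unfolding prefix_route_eq_iff[OF s w1 w2] by blast
qed

text \<open>Prefixes ending in \<open>u\<close> or past both \<open>B\<close> and \<open>y\<close>
  have a counterpart with the same letters, and those ending inside \<open>B\<close> are covered by
  \<open>prefix_route_inside_block\<close>. Only the end of \<open>B\<close> is left over.\<close>

lemma Delta_subset:
  "Delta s (u @ B @ y # v) \<subseteq> insert (prefix_route s (u @ B)) (Delta s (u @ y # B @ v))"
proof
  fix R assume "R \<in> Delta s (u @ B @ y # v)"
  then obtain p p' where R: "R = prefix_route s p" and e: "u @ B @ y # v = p @ p'"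
    unfolding Delta_eq[OF w] by auto
  have mem: "prefix_route s q \<in> Delta s (u @ y # B @ v)" if "u @ y # B @ v = q @ q'" for q q'
    using that Delta_eq[OF stirling_moved] by blast
  from prefix_of_append[OF e]
  show "R \<in> insert (prefix_route s (u @ B)) (Delta s (u @ y # B @ v))"
  proof (elim disjE exE conjE)
    fix t assume "u = p @ t"
    then show ?thesis using mem[of p "t @ y # B @ v"] R by simp
  next
    fix t assume t: "p = u @ t" "B @ y # v = t @ p'"
    from prefix_of_append[OF t(2)] show ?thesis
    proof (elim disjE exE conjE)
      fix B2 assume B2: "B = t @ B2"
      consider "t = []" | "B2 = []" | "t \<noteq> []" "B2 \<noteq> []" by blast
      then show ?thesis
      proof cases
        case 1
        then show ?thesis using mem[of u "y # B @ v"] t R by simp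
      next
        case 2
        then show ?thesis using t R B2 by simp
      next
        case 3
        then show ?thesis
          using mem[of "u @ y # t" "B2 @ v"] prefix_route_inside_block[OF B2] t R B2 by simp
      qed
    next
      fix t2 assume t2: "t = B @ t2" "y # v = t2 @ p'"
      show ?thesis
      proof (cases t2)
        case Nil
        then show ?thesis using t t2 R by simp
      next
        case (Cons y' t3)
        then have "v = t3 @ p'" "p = u @ B @ y # t3" using t t2 by auto
        moreover have "prefix_route s (u @ B @ y # t3) = prefix_route s (u @ y # B @ t3)"
          by (rule prefix_route_cong) simp
        ultimately show ?thesis using mem[of "u @ y # B @ t3" p'] R by simp
      qed
    qed
  qed
qed

lemma Delta_moved_subset:
  "Delta s (u @ y # B @ v) \<subseteq> insert (prefix_route s (u @ [y])) (Delta s (u @ B @ y # v))"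
proof
  fix R assume "R \<in> Delta s (u @ y # B @ v)"
  then obtain p p' where R: "R = prefix_route s p" and e: "u @ y # B @ v = p @ p'"
    unfolding Delta_eq[OF stirling_moved] by auto
  have mem: "prefix_route s q \<in> Delta s (u @ B @ y # v)" if "u @ B @ y # v = q @ q'" for q q'
    using that Delta_eq[OF w] by blast
  from prefix_of_append[OF e]
  show "R \<in> insert (prefix_route s (u @ [y])) (Delta s (u @ B @ y # v))"
  proof (elim disjE exE conjE)
    fix t assume "u = p @ t"
    then show ?thesis using mem[of p "t @ B @ y # v"] R by simp
  next
    fix t assume t: "p = u @ t" "y # B @ v = t @ p'"
    show ?thesis
    proof (cases t)
      case Nil
      then show ?thesis using mem[of u "B @ y # v"] t R by simp
    next
      case (Cons y' t')
      then have t': "p = u @ y # t'" "B @ v = t' @ p'" using t by auto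
      from prefix_of_append[OF t'(2)] show ?thesis
      proof (elim disjE exE conjE)
        fix B2 assume B2: "B = t' @ B2"
        consider "t' = []" | "B2 = []" | "t' \<noteq> []" "B2 \<noteq> []" by blast
        then show ?thesis
        proof cases
          case 1
          then show ?thesis using t' R by simp
        next
          case 2
          have "prefix_route s (u @ y # B) = prefix_route s (u @ B @ [y])"
            by (rule prefix_route_cong) simp
          then show ?thesis using 2 mem[of "u @ B @ [y]" v] t' R B2 by simp
        next
          case 3
          then show ?thesis
            using mem[of "u @ t'" "B2 @ y # v"] prefix_route_inside_block[OF B2] t' R B2 by simp
        qed
      next
        fix t2 assume t2: "t' = B @ t2" "v = t2 @ p'"
        have "prefix_route s (u @ y # B @ t2) = prefix_route s (u @ B @ y # t2)"
          by (rule prefix_route_cong) simp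
        then show ?thesis using mem[of "u @ B @ y # t2" p'] t2 t' R by simp
      qed
    qed
  qed
qed

lemma Delta_diff:
  "Delta s (u @ B @ y # v) - Delta s (u @ y # B @ v) = {prefix_route s (u @ B)}"
  "Delta s (u @ y # B @ v) - Delta s (u @ B @ y # v) = {prefix_route s (u @ [y])}"
proof -
  obtain b B' where B': "B = b # B'" using B(1) by (cases B) auto
  have b: "b < y" "y \<notin> set B'" using less_y B' by auto
  have w1: "stirling_perm s (u @ (b # B') @ y # v)" using w B' by simp
  have "y \<le> first_open s (u @ b # B')" using next_le_first_open[OF s, of "u @ b # B'" y v] w1 by simp
  then have "prefix_route s (u @ B) \<notin> Delta s (u @ y # B @ v)"
    using route_not_in_upper[OF s w1 stirling_moved b] B' by simp
  moreover have "prefix_route s (u @ B) \<in> Delta s (u @ B @ y # v)"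
    using Delta_prefixI[of s "u @ B" "y # v"] w by simp
  ultimately show "Delta s (u @ B @ y # v) - Delta s (u @ y # B @ v) = {prefix_route s (u @ B)}"
    using Delta_subset by blast
  have "prefix_route s (u @ [y]) \<notin> Delta s (u @ B @ y # v)"
    using route_not_in_lower[OF s _ stirling_moved b(1), of "B' @ y # v"] w1 B' by simp
  moreover have "prefix_route s (u @ [y]) \<in> Delta s (u @ y # B @ v)"
    using Delta_prefixI[of s "u @ [y]" "B @ v"] stirling_moved by simp
  ultimately show "Delta s (u @ y # B @ v) - Delta s (u @ B @ y # v) = {prefix_route s (u @ [y])}"
    using Delta_moved_subset by blast
qed

end

section \<open>Covers and differences in one route\<close>

text \<open>The letter to move is the \<open>y\<close> by which \<open>w'\<close> first departs from
  \<open>w\<close>, taken at its next occurrence in \<open>w\<close>; it crosses the block ending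
  directly before it.\<close>

lemma weak_less_block_move:
  assumes s: "composition s" and w: "stirling_perm s w" and w': "stirling_perm s w'"
    and less: "weak_less s w w'"
  obtains u B y v where "block_move s u B y v" "w = u @ B @ y # v"
    "weak_le s (u @ y # B @ v) w'"
proof -
  have le: "weak_le s w w'" and ne: "w \<noteq> w'" using less by (auto simp: weak_less_def)
  obtain u x v y v' where d: "w = u @ x # v" "w' = u @ y # v'" "x \<noteq> y"
    using first_difference[OF s w w' ne] by blast
  note w = w[unfolded d] and w' = w'[unfolded d]
  have xy: "x < y" using weak_le_first_difference[OF s w w' d(3)] le d by simp
  obtain q r where q: "v = q @ y # r" "y \<notin> set (x # q)"
    using next_occurrence[OF s w w' d(3)] by blast
  let ?Q = "x # q"
  have wQ: "w = u @ ?Q @ y # r" "stirling_perm s (u @ ?Q @ y # r)" using d q w by auto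
  have y1: "1 \<le> y" "y \<le> length s" using set_stirling[OF s w'] by auto
  \<comment> \<open>If \<open>b > y\<close> stood before the next \<open>y\<close> of
    \<open>w\<close>, then 121-avoidance would make the block of \<open>y\<close> in
    \<open>w\<close> start behind \<open>b\<close>. In \<open>w'\<close> it starts right after
    \<open>u\<close>, so \<open>w\<close> would have more inversions of \<open>b\<close> and
    \<open>y\<close>.\<close>
  have Qy: "b < y" if b: "b \<in> set ?Q" for b
  proof (rule ccontr)
    assume "\<not> b < y"
    then have by': "y < b" using b q(2) by (metis linorder_neqE_nat)
    obtain Q1 Q2 where Q12: "?Q = Q1 @ b # Q2" using split_list[OF b] by blast
    have "y \<notin> set u"
      using stirling_121[of s "u @ Q1" b "Q2 @ y # r" y] wQ(2) Q12 by' by auto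
    moreover have "y \<notin> set (u @ ?Q)" using calculation q(2) by auto
    moreover have "w = (u @ ?Q) @ y # r" using wQ by simp
    ultimately have "inversions w b y = count_list (u @ ?Q) b" "inversions w' b y = count_list u b"
      using inversions_first d(2) by metis+
    moreover have "0 < count_list ?Q b" using b by (metis count_list_0_iff gr0I)
    ultimately have "inversions w' b y < inversions w b y" by simp
    moreover have "b \<le> length s" using set_stirling[OF s wQ(2)] b by auto
    ultimately show False using le by' y1 unfolding weak_le_def by (meson linorder_not_le)
  qed
  have Qu: "b \<notin> set u" if "b \<in> set ?Q" for b
    using not_in_common_prefix[OF s w w', of b] that Qy[OF that] q(1) by auto
  \<comment> \<open>The last letter before the next \<open>y\<close>; the block to cross runs from
    its first occurrence to this last one.\<close>
  define b where "b = last ?Q"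
  have b: "b \<in> set ?Q" by (simp add: b_def)
  obtain q1 q2 where Q: "?Q = q1 @ b # q2" "b \<notin> set q1" using split_list_first[OF b] by blast
  let ?B = "b # q2"
  interpret bm: block_move s "u @ q1" ?B y r
  proof
    show "stirling_perm s ((u @ q1) @ ?B @ y # r)" using wQ(2) Q(1) by simp
    show "hd ?B = last ?B" using arg_cong[OF Q(1), of last] by (simp add: b_def)
    show "hd ?B < y" "hd ?B \<notin> set (u @ q1)" using Qy[OF b] Qu[OF b] Q(2) by auto
  qed (use s in auto)
  have weq: "w = (u @ q1) @ ?B @ y # r" using wQ(1) Q(1) by simp
  have "weak_le s ((u @ q1) @ y # ?B @ r) w'"
    unfolding weak_le_def
  proof (intro allI impI, elim conjE)
    fix a c assume ac: "1 \<le> a" "a < c" "c \<le> length s"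
    show "inversions ((u @ q1) @ y # ?B @ r) c a \<le> inversions w' c a"
    proof (cases "c = y \<and> a \<in> set ?B")
      case True
      then have aQ: "a \<in> set ?Q" using Q(1) by auto
      \<comment> \<open>There is room for one more inversion: in \<open>w\<close> the block of
        \<open>a\<close> starts before the next \<open>y\<close>, in \<open>w'\<close> only behind
        the \<open>y\<close> following \<open>u\<close>.\<close>
      have "inversions w y a \<le> count_list (u @ ?Q) y"
        using inversions_le[of a "u @ ?Q" "y # r" y] aQ unfolding wQ(1) by auto
      also have "\<dots> = count_list u y" using q(2) by (simp add: count_list_0_iff)
      finally have "inversions w y a + 1 \<le> count_list (u @ [y]) y" by simp
      also have "\<dots> \<le> inversions ((u @ [y]) @ v') y a"
      proof (rule inversions_ge)
        show "a \<notin> set (u @ [y])" using Qu[OF aQ] ac True by auto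
        have "a \<in> {1..length s}" using ac by auto
        then have "a \<in> set (y # v')" using rest_has_letter[OF w w'] aQ q(1) by auto
        then show "a \<in> set v'" using ac True by auto
      qed
      finally show ?thesis
        using bm.inversions_moved[OF ac] True weq d(2) by simp
    next
      case False
      then show ?thesis
        using bm.inversions_moved[OF ac] le ac weq unfolding weak_le_def by auto
    qed
  qed
  then show thesis using that bm.block_move_axioms weq by blast
qed

text \<open>One move from \<open>w\<close> leads to a word still below or equal to
  \<open>w'\<close>; a cover leaves only \<open>w'\<close> for it.\<close>

lemma weak_covered_card:
  assumes s: "composition s" and "weak_covered s w w'"
  shows "card (Delta s w - Delta s w') = 1 \<and> card (Delta s w' - Delta s w) = 1"
proof -
  have w: "stirling_perm s w" and w': "stirling_perm s w'" and less: "weak_less s w w'"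
    and cover: "\<And>x. stirling_perm s x \<Longrightarrow> weak_less s w x \<Longrightarrow> \<not> weak_less s x w'"
    using assms(2) unfolding weak_covered_def by blast+
  obtain u B y v where m: "block_move s u B y v" "w = u @ B @ y # v"
    "weak_le s (u @ y # B @ v) w'"
    using weak_less_block_move[OF s w w' less] by blast
  interpret block_move s u B y v by (rule m(1))
  have "weak_less s w (u @ y # B @ v)"
    using weak_le_moved moved_ne m(2) by (simp add: weak_less_def)
  then have "w' = u @ y # B @ v"
    using cover[OF stirling_moved] m(3) by (auto simp: weak_less_def)
  then show ?thesis using Delta_diff m(2) by simp
qed

lemma prefix_route_inject:
  assumes "composition s" "stirling_perm s (p @ q @ r)" "prefix_route s p = prefix_route s (p @ q)"
  shows "q = []"
proof -
  let ?w = "p @ q @ r"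
  have "length p = length (p @ q)"
    by (rule inj_onD[OF inj_on_prefix_route[OF assms(1,2)]]) (use assms(3) in auto)
  then show ?thesis by simp
qed

text \<open>A single lost route forces the stretch before the next \<open>y\<close> to be one block.
  The move across it yields the same routes as the upper word, and the routes determine the
  word.\<close>

lemma card_one_covered:
  assumes s: "composition s" and w: "stirling_perm s (u @ x # v)"
    and w': "stirling_perm s (u @ y # v')" and xy: "x < y"
    and card: "card (Delta s (u @ x # v) - Delta s (u @ y # v')) = 1"
      "card (Delta s (u @ y # v') - Delta s (u @ x # v)) = 1"
  shows "weak_covered s (u @ x # v) (u @ y # v')"
proof -
  let ?w = "u @ x # v" and ?w' = "u @ y # v'"
  obtain q r where q: "v = q @ y # r" "y \<notin> set (x # q)"
    using next_occurrence[OF s w w'] xy by blast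
  let ?Q = "x # q"
  have wQ: "stirling_perm s (u @ ?Q @ y # r)" using q w by simp
  \<comment> \<open>Every prefix between \<open>u x\<close> and the next \<open>y\<close> whose
    route still shows the count of \<open>y\<close> loses its route. Since one route is lost, only
    the full stretch can qualify.\<close>
  have lost: "prefix_route s (u @ x # q0) \<in> Delta s ?w - Delta s ?w'"
    if "q = q0 @ q1" "y \<le> first_open s (u @ x # q0)" for q0 q1
  proof -
    have st: "stirling_perm s (u @ (x # q0) @ q1 @ y # r)" using w q(1) that(1) by simp
    have "y \<notin> set q0" using q(2) that(1) by simp
    then show ?thesis
      using route_not_in_upper[OF s st w' xy _ that(2)] st that(1) q(1)
        Delta_prefixI[of s "u @ x # q0" "q1 @ y # r"] by simp
  qed
  have cQ: "y \<le> first_open s (u @ x # q)"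
    using next_le_first_open[OF s, of "u @ ?Q" y r] wQ by simp
  have only: "q1 = []" if "q = q0 @ q1" "y \<le> first_open s (u @ x # q0)" for q0 q1
  proof -
    have "prefix_route s (u @ x # q0) = prefix_route s (u @ x # q)"
      using lost[OF that] lost[of q "[]"] cQ card(1) by (metis append_Nil2 card_1_singletonE singletonD)
    then show ?thesis
      using prefix_route_inject[OF s, of "u @ x # q0" q1 "y # r"] wQ that(1) by simp
  qed
  \<comment> \<open>The prefix just before a letter \<open>b\<close> that is not below
    \<open>y\<close> has no open letter below \<open>b\<close>, so its route would be a second lost
    one.\<close>
  have Qy: "b < y" if b: "b \<in> set ?Q" for b
  proof (rule ccontr)
    assume by': "\<not> b < y"
    then have "b \<in> set q" using b xy by auto
    then obtain q0 q1 where q01: "q = q0 @ b # q1" using split_list by metis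
    have "b \<le> first_open s (u @ x # q0)"
      using next_le_first_open[OF s, of "u @ x # q0" b "q1 @ y # r"] wQ q01 by simp
    then show False using only[OF q01] by' by simp
  qed
  have Qu: "b \<notin> set u" if "b \<in> set ?Q" for b
    using not_in_common_prefix[OF s w w', of b] that Qy[OF that] q(1) by auto
  define b where "b = last ?Q"
  have b: "b \<in> set ?Q" by (simp add: b_def)
  obtain q1 q2 where Q: "?Q = q1 @ b # q2" "b \<notin> set q1" using split_list_first[OF b] by blast
  let ?B = "b # q2"
  interpret bm: block_move s "u @ q1" ?B y r
  proof
    show "stirling_perm s ((u @ q1) @ ?B @ y # r)" using wQ Q(1) by simp
    show "hd ?B = last ?B" using arg_cong[OF Q(1), of last] by (simp add: b_def)
    show "hd ?B < y" "hd ?B \<notin> set (u @ q1)" using Qy[OF b] Qu[OF b] Q(2) by auto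
  qed (use s in auto)
  have "q1 = []"
  proof (cases q1)
    case (Cons x' q0)
    then have q0: "q1 = x # q0" "q = q0 @ ?B" using Q(1) by auto
    \<comment> \<open>The cut before the last block would lose a second route: a letter below
      \<open>y\<close> open there cannot recur behind \<open>y\<close>, so it would lie in
      \<open>?B\<close>, against \<open>not_before\<close>.\<close>
    have "y \<le> first_open s (u @ q1)"
    proof (rule le_first_openI)
      show "stirling_perm s ((u @ q1) @ ?B @ y # r)" using bm.w .
      have "y \<in> {1..length s}" unfolding set_stirling[OF s w', symmetric] by simp
      then show "y \<le> length s + 1" by simp
      fix a assume a: "a < y" "a \<in> set (u @ q1)" "a \<in> set (?B @ y # r)"
      have "a \<notin> set r"
        using stirling_121[of s "u @ ?Q" y r a] wQ a(1,2) Q(1) by auto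
      then have aB: "a \<in> set ?B" using a by auto
      then show False using bm.not_before[OF aB] a(2) by simp
    qed
    then show ?thesis using only[OF q0(2)] q0(1) by simp
  qed simp
  then have weq: "?w = u @ ?B @ y # r" using Q(1) q(1) by simp
  interpret mv: block_move s u ?B y r using bm.block_move_axioms \<open>q1 = []\<close> by simp
  let ?w'' = "u @ y # ?B @ r"
  have "prefix_route s (u @ ?B) \<in> Delta s ?w - Delta s ?w'"
    using lost[of q "[]"] cQ Q(1) \<open>q1 = []\<close> by simp
  moreover have "prefix_route s (u @ [y]) \<in> Delta s ?w' - Delta s ?w"
    using route_not_in_lower[OF s w w' xy] Delta_prefixI[of s "u @ [y]" v'] w' by simp
  ultimately have "Delta s ?w - Delta s ?w' = {prefix_route s (u @ ?B)}"
    "Delta s ?w' - Delta s ?w = {prefix_route s (u @ [y])}"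
    using card by (metis card_1_singletonE singletonD)+
  moreover have "Delta s ?w - Delta s ?w'' = {prefix_route s (u @ ?B)}"
    "Delta s ?w'' - Delta s ?w = {prefix_route s (u @ [y])}"
    using mv.Delta_diff weq by simp_all
  \<comment> \<open>Both sets arise from \<open>Delta s ?w\<close> by removing the same route and
    adding the same route.\<close>
  ultimately have "Delta s ?w' = Delta s ?w''" by blast
  then have "?w' = ?w''" by (rule Delta_inject[OF s w' mv.stirling_moved])
  then show ?thesis using mv.covered weq by simp
qed

theorem theorem6p11:
  fixes s w w' :: "nat list" and lab :: "'e::finite \<Rightarrow> edge"
  assumes "composition s"
    and "stirling_perm s w" and "stirling_perm s w'"
    and "bij_betw lab UNIV (arcs (oruga s))"
  shows "(weak_covered s w w' \<or> weak_covered s w' w \<longleftrightarrow>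
           adjacent_in (dkk_triangulation s lab)
             (route_simplex lab (Delta s w)) (route_simplex lab (Delta s w'))) \<and>
         (adjacent_in (dkk_triangulation s lab)
             (route_simplex lab (Delta s w)) (route_simplex lab (Delta s w')) \<longleftrightarrow>
           card (Delta s w - Delta s w') = 1 \<and> card (Delta s w' - Delta s w) = 1)"
proof -
  have "weak_covered s w w' \<or> weak_covered s w' w"
    if card: "card (Delta s w - Delta s w') = 1" "card (Delta s w' - Delta s w) = 1"
  proof -
    have "w \<noteq> w'" using card by auto
    then obtain u x v y v' where d: "w = u @ x # v" "w' = u @ y # v'" "x \<noteq> y"
      using first_difference[OF assms(1-3)] by blast
    then show ?thesis
      using card_one_covered[OF assms(1), of u x v y v'] card_one_covered[OF assms(1), of u y v' x v]
        assms(2,3) card by (cases x y rule: linorder_cases) auto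
  qed
  then show ?thesis
    using weak_covered_card[OF assms(1)] adjacent_in_iff_card[OF assms] by blast
qed

end
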